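(* Let $Q_\infty^\infty$ be the uniform infinite half-planar quadrangulation (UIHPQ), with boundary $\partial Q_\infty^\infty$. Almost surely, every geodesic ray in $Q_\infty^\infty$ hits the boundary $\partial Q_\infty^\infty$ infinitely many times. More specifically, almost surely there is an infinite sequence of distinct vertices, all lying on the boundary $\partial Q_\infty^\infty$, such that every geodesic ray in $Q_\infty^\infty$ (started from an arbitrary vertex) passes through every vertex of this sequence except maybe for a finite number.
   Context: Notation: $\mathbb N=\{1,2,\dots\}$, $\mathbb Z_+=\{0,1,2,\dots\}$, $\mathbb Z_-=\{\dots,-2,-1,0\}$. **Uniform infinite treed bridge.** A well-labeled tree $(\tau,\ell)$ is a finite rooted plane tree $\tau$ with integer vertex labels $\ell$ such that labels of adjacent vertices differ by at most 1. For $k\in\mathbb Z$, $\rho_k$ is the probability measure on well-labeled trees with root label $k$ given by $\rho_k((\tau,\ell))=\tfrac12 12^{-|\tau|}$, $|\tau|$ the number of edges. Let $b=(b(i):i\in\mathbb Z)$ be a two-sided simple symmetric random walk with $b(0)=0$ (the sides $i\ge0$ and $i\le0$ are independent simple symmetric random walks from $0$). An index $i$ is a down-step if $b(i+1)=b(i)-1$; $DS(b)$ is the set of down-steps. Conditionally on $b$, let $T(i)$, $i\in DS(b)$, be independent well-labeled trees with $T(i)$ of law $\rho_{b(i)}$. **The UIHPQ.** Embed $\mathbb Z$ as a horizontal line with $i$ labeled $b(i)$, and for $i\in DS(b)$ graft $T(i)$ in the upper half-plane, identifying its root with the vertex $i$. Vertices of the trees $T(i)$ (including the roots $i\in DS(b)$)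 are called real. A real corner is a corner (angular sector between consecutive edges) in the upper half-plane incident to a real vertex. List the real corners in left-to-right (clockwise contour) order as $(c_n)_{n\in\mathbb Z}$, where $c_0$ is the leftmost real corner with label $0$ belonging to a tree $T(i)$ with $i\in DS(b)\cap\mathbb Z_+$; the label of a corner is the label of its vertex. The successor $\mathrm{succ}(c_n)$ is the first corner among $c_{n+1},c_{n+2},\dots$ with label $\ell(c_n)-1$ (it exists almost surely). The UIHPQ $Q_\infty^\infty$ is the infinite planar map whose vertices are the real vertices and whose edges are the arcs (drawn without crossings in the upper half-plane) joining $c_n$ to $\mathrm{succ}(c_n)$, for all $n\in\mathbb Z$ (multiple edges are possible). **Boundary.** Define $\varphi:\mathbb Z\to V(Q_\infty^\infty)$ by $\varphi(i)=i$ if $i\in DS(b)$, and otherwise $\varphi(i)$ is the vertex incident to the first real corner to the right of $i$ with label $b(i)$. The set of boundary vertices is $\partial Q_\infty^\infty=\varphi(\mathbb Z)$. The root vertex is $\varphi(0)$, and the root edge goes from $\varphi(0)$ to $\varphi(1)$. **Geodesic rays.** With $d_{\mathrm{gr}}$ the graph distance on $Q_\infty^\infty$, a geodesic ray is an infinite path visiting vertices $\gamma(0),\gamma(1),\dots$ with $d_{\mathrm{gr}}(\gamma(i),\gamma(j))=|i-j|$ for all $i,j\in\mathbb Z_+$. *)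

theory Defs
  imports
    "HOL-Probability.Probability"
    "HOL-Library.Extended_Nat"
    "Graph_Theory.Digraph"
begin

section \<open>Well-labeled trees\<close>

text \<open>
  A finite rooted plane tree with integer vertex labels. The children are listed from left to
  right, as seen when the tree is drawn growing upwards from its root.
\<close>

datatype ltree = Node (root_label: int) (children: "ltree list")

fun well_labeled :: "ltree \<Rightarrow> bool" where
  "well_labeled (Node l ts) \<longleftrightarrow> (\<forall>t\<in>set ts. \<bar>root_label t - l\<bar> \<le> 1 \<and> well_labeled t)"

fun num_edges :: "ltree \<Rightarrow> nat" where
  "num_edges (Node l ts) = (\<Sum>t\<leftarrow>ts. Suc (num_edges t))"

text \<open>
  Vertices of a tree are addressed by the list of child indices leading to them from the root.
\<close>

fun is_address :: "ltree \<Rightarrow> nat list \<Rightarrow> bool" where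
  "is_address t [] \<longleftrightarrow> True"
| "is_address (Node l ts) (k # p) \<longleftrightarrow> k < length ts \<and> is_address (ts ! k) p"

fun label_at :: "ltree \<Rightarrow> nat list \<Rightarrow> int" where
  "label_at t [] = root_label t"
| "label_at (Node l ts) (k # p) = label_at (ts ! k) p"

text \<open>
  The vertices incident to the successive corners in clockwise contour order, for a tree grafted
  on a horizontal line in the upper half-plane. A vertex with \<open>k\<close> children has \<open>k + 1\<close> corners.
  This includes the root: the line separates its leftmost corner from its rightmost one.
\<close>

primrec contour :: "ltree \<Rightarrow> nat list list" where
  "contour (Node l ts) =
     [] # concat (map2 (\<lambda>k c. map (Cons k) c @ [[]]) [0..<length ts] (map contour ts))"

definition tree_law :: "int \<Rightarrow> ltree measure" (\<open>\<rho>\<close>) where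
  "\<rho> k = density (count_space UNIV)
     (\<lambda>t. if well_labeled t \<and> root_label t = k then ennreal (1/2 * (1/12) ^ num_edges t) else 0)"

section \<open>The uniform infinite treed bridge\<close>

definition DS :: "(int \<Rightarrow> int) \<Rightarrow> int set" where
  "DS b = {i. b (i + 1) = b i - 1}"

definition (in prob_space) simple_random_walk :: "('a \<Rightarrow> nat \<Rightarrow> int) \<Rightarrow> bool" where
  "simple_random_walk X \<longleftrightarrow>
     X \<in> M \<rightarrow>\<^sub>M (\<Pi>\<^sub>M n\<in>UNIV. count_space UNIV) \<and>
     (AE \<omega> in M. X \<omega> 0 = 0) \<and>
     indep_vars (\<lambda>_. count_space UNIV) (\<lambda>n \<omega>. X \<omega> (Suc n) - X \<omega> n) UNIV \<and>
     (\<forall>n. distr M (count_space UNIV) (\<lambda>\<omega>. X \<omega> (Suc n) - X \<omega> n)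
            = measure_pmf (pmf_of_set {-1, 1}))"

text \<open>
  The last assumption says that, conditionally on \<open>b\<close>, the trees \<open>T i\<close> for \<open>i \<in> DS b\<close> are
  independent and \<open>T i\<close> has law \<open>\<rho> (b i)\<close>. As \<open>DS b\<close> is random, it is formulated on the events
  \<open>J \<subseteq> DS b\<close> for fixed finite \<open>J\<close>. The values \<open>T i\<close> for \<open>i \<notin> DS b\<close> are arbitrary (measurable) and
  are never used below.
\<close>

locale uniform_infinite_treed_bridge = prob_space M for M :: "'w measure" +
  fixes b :: "'w \<Rightarrow> int \<Rightarrow> int" and T :: "'w \<Rightarrow> int \<Rightarrow> ltree"
  assumes b_measurable: "b \<in> M \<rightarrow>\<^sub>M (\<Pi>\<^sub>M i\<in>UNIV. count_space UNIV)"
    and b_right: "simple_random_walk (\<lambda>\<omega> n. b \<omega> (int n))"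
    and b_left: "simple_random_walk (\<lambda>\<omega> n. b \<omega> (- int n))"
    and b_sides_independent:
      "indep_var (\<Pi>\<^sub>M n\<in>UNIV. count_space UNIV) (\<lambda>\<omega> (n::nat). b \<omega> (int n))
                 (\<Pi>\<^sub>M n\<in>UNIV. count_space UNIV) (\<lambda>\<omega> (n::nat). b \<omega> (- int n))"
    and T_measurable: "T \<in> M \<rightarrow>\<^sub>M (\<Pi>\<^sub>M i\<in>UNIV. count_space UNIV)"
    and T_conditional_law:
      "\<And>(J :: int set) (B :: int \<Rightarrow> ltree set). finite J \<Longrightarrow>
         AE \<omega> in M.
           real_cond_exp M
             (vimage_algebra (space M) b (\<Pi>\<^sub>M i\<in>UNIV. count_space UNIV))
             (indicat_real {\<omega> \<in> space M. J \<subseteq> DS (b \<omega>) \<and> (\<forall>i\<in>J. T \<omega> i \<in> B i)}) \<omega>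
           = indicat_real {\<omega>. J \<subseteq> DS (b \<omega>)} \<omega> * (\<Prod>i\<in>J. measure (\<rho> (b \<omega> i)) (B i))"

section \<open>Real vertices and corners\<close>

text \<open>
  A vertex is a pair of a position on the line and an address in the tree grafted there; the
  vertex \<open>i\<close> of the line with \<open>i \<in> DS b\<close> is \<open>(i, [])\<close>. A corner is a pair of a position on the line
  and an index in the contour of the tree grafted there. The left-to-right order of corners is
  then lexicographic.
\<close>

type_synonym vertex = "int \<times> nat list"
type_synonym corner = "int \<times> nat"

definition real_vertices :: "(int \<Rightarrow> int) \<Rightarrow> (int \<Rightarrow> ltree) \<Rightarrow> vertex set" where
  "real_vertices b T = {(i, p). i \<in> DS b \<and> is_address (T i) p}"

definition real_corners :: "(int \<Rightarrow> int) \<Rightarrow> (int \<Rightarrow> ltree) \<Rightarrow> corner set" where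
  "real_corners b T = {(i, m). i \<in> DS b \<and> m < length (contour (T i))}"

definition corner_vertex :: "(int \<Rightarrow> ltree) \<Rightarrow> corner \<Rightarrow> vertex" where
  "corner_vertex T c = (fst c, contour (T (fst c)) ! snd c)"

definition corner_label :: "(int \<Rightarrow> ltree) \<Rightarrow> corner \<Rightarrow> int" where
  "corner_label T c = (case corner_vertex T c of (i, p) \<Rightarrow> label_at (T i) p)"

definition corner_less :: "corner \<Rightarrow> corner \<Rightarrow> bool" where
  "corner_less c c' \<longleftrightarrow> fst c < fst c' \<or> fst c = fst c' \<and> snd c < snd c'"

text \<open>
  The leftmost real corner with property \<open>P\<close>. In the two uses below it exists almost surely;
  otherwise the value is unspecified.
\<close>

definition first_corner ::
    "(int \<Rightarrow> int) \<Rightarrow> (int \<Rightarrow> ltree) \<Rightarrow> (corner \<Rightarrow> bool) \<Rightarrow> corner" where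
  "first_corner b T P = (THE c. c \<in> real_corners b T \<and> P c \<and>
     (\<forall>c' \<in> real_corners b T. P c' \<longrightarrow> c = c' \<or> corner_less c c'))"

definition succ_corner :: "(int \<Rightarrow> int) \<Rightarrow> (int \<Rightarrow> ltree) \<Rightarrow> corner \<Rightarrow> corner" where
  "succ_corner b T c =
     first_corner b T (\<lambda>c'. corner_less c c' \<and> corner_label T c' = corner_label T c - 1)"

section \<open>The UIHPQ, its boundary and its geodesic rays\<close>

text \<open>
  The multigraph underlying the map: each real corner \<open>c\<close> contributes one edge, from the vertex
  of \<open>c\<close> to the vertex of its successor. The orientation is ignored by \<open>adjacency\<close>.
\<close>

definition uihpq :: "(int \<Rightarrow> int) \<Rightarrow> (int \<Rightarrow> ltree) \<Rightarrow> (vertex, corner) pre_digraph" where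
  "uihpq b T =
     \<lparr> verts = real_vertices b T,
       arcs = real_corners b T,
       tail = corner_vertex T,
       head = (\<lambda>c. corner_vertex T (succ_corner b T c)) \<rparr>"

definition boundary_vertex :: "(int \<Rightarrow> int) \<Rightarrow> (int \<Rightarrow> ltree) \<Rightarrow> int \<Rightarrow> vertex" (\<open>\<phi>\<close>) where
  "\<phi> b T i =
     (if i \<in> DS b then (i, [])
      else corner_vertex T (first_corner b T (\<lambda>c. i < fst c \<and> corner_label T c = b i)))"

definition boundary :: "(int \<Rightarrow> int) \<Rightarrow> (int \<Rightarrow> ltree) \<Rightarrow> vertex set" where
  "boundary b T = range (\<phi> b T)"

definition adjacency :: "('v, 'e) pre_digraph \<Rightarrow> 'v rel" where
  "adjacency G = arcs_ends G \<union> (arcs_ends G)\<inverse>"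

definition graph_dist :: "('v, 'e) pre_digraph \<Rightarrow> 'v \<Rightarrow> 'v \<Rightarrow> enat" where
  "graph_dist G u v = (INF n \<in> {n. (u, v) \<in> adjacency G ^^ n}. enat n)"

definition geodesic_ray :: "('v, 'e) pre_digraph \<Rightarrow> (nat \<Rightarrow> 'v) \<Rightarrow> bool" where
  "geodesic_ray G \<gamma> \<longleftrightarrow>
     (\<forall>n. \<gamma> n \<in> verts G) \<and>
     (\<forall>n. (\<gamma> n, \<gamma> (Suc n)) \<in> adjacency G) \<and>
     (\<forall>i j. graph_dist G (\<gamma> i) (\<gamma> j) = enat (nat \<bar>int i - int j\<bar>))"

end

theory Submission
  imports Defs
begin

text \<open>
  Adjacent vertices have labels differing by \<open>1\<close>, and every arc descends. Call a down-step
  \<open>j \<ge> 0\<close> a record if \<open>b j\<close> lies below all labels of the trees grafted on \<open>[0, j)\<close>, and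
  \<open>i < 0\<close> a barrier if \<open>b i\<close> lies below all labels of the trees grafted on \<open>[i, 0)\<close>. No arc
  leads from the left of a barrier \<open>i\<close> into \<open>[i, 0)\<close>, and the only arcs leaving \<open>[0, j)\<close> to the right
  for a record \<open>j\<close> end at the boundary vertex \<open>j\<close>. So, if there are infinitely many barriers, a
  geodesic ray cannot stay on the left half-line; it cannot cross the origin infinitely often either,
  since this would force it to descend at each step, and descending paths never move to the left.
  Hence it finally stays on the right half-line and passes through all but finitely many records.

  Records and barriers are renewal processes, so it suffices that their expected number is infinite.
  For a well-labeled tree with root label \<open>x\<close>, the smallest label is positive with probability
  \<open>x (x + 3) / ((x + 1) (x + 2))\<close>; with this weight the probability that the walk produces a record at
  level \<open>-x\<close> is exactly \<open>1 / (x + 1)\<close>, and for barriers it is \<open>3 / (x + 3)\<close>. Both series diverge.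
\<close>

section \<open>Labels along the contour\<close>

text \<open>A tree may reach arbitrarily far below its root, so a new minimum of the walk alone
  separates nothing: a record has to lie below the trees as well. This makes the chance of a record
  at depth \<open>x\<close> decay like \<open>1 / x\<close>, which is only just enough for
  divergence, so precise constants are needed.

  The exact values serve as guides; only lower bounds are proved. The tree bound is an induction on
  a truncation height, because \<open>x (x + 3) / ((x + 1) (x + 2))\<close> is a fixed point of the
  monotone recursion over the children of the root. It is half of the two-point function of planar
  quadrangulations at the critical weight \<open>1/12\<close> per edge. The functions
  \<open>1 / (x + 1)\<close> and \<open>3 / (x + 3)\<close> have value 1 at 0, tend to 0 and solve
  the recursions for the expected number of visits of the walk killed when a tree reaches too low; a
  maximum principle compares them with the true expectations.

  The walk and the trees become one i.i.d. sequence on each side of the origin once every tree is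
  shifted to root label 0. Divergence then yields infinitely many records and barriers by a renewal
  argument.\<close>

fun tree_labels :: "ltree \<Rightarrow> int set" where
  "tree_labels (Node l ts) = insert l (\<Union>t\<in>set ts. tree_labels t)"

lemma finite_tree_labels: "finite (tree_labels t)"
  by (induction t) auto

lemma root_label_in_tree_labels: "root_label t \<in> tree_labels t"
  by (cases t) auto

lemma label_at_in_tree_labels: "is_address t p \<Longrightarrow> label_at t p \<in> tree_labels t"
proof (induction t p rule: is_address.induct)
  case (1 t) then show ?case by (simp add: root_label_in_tree_labels)
next
  case (2 l ts k p)
  then have "label_at (ts ! k) p \<in> tree_labels (ts ! k)" "ts ! k \<in> set ts" by auto
  then show ?case by auto
qed

definition contour_labels :: "ltree \<Rightarrow> int list" where
  "contour_labels t = map (label_at t) (contour t)"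

lemma contour_labels_Node:
  "contour_labels (Node l ts) = l # concat (map (\<lambda>t. contour_labels t @ [l]) ts)"
proof -
  have "map (map (label_at (Node l ts)))
          (map2 (\<lambda>k c. map (Cons k) c @ [[]]) [0..<length ts] (map contour ts))
        = map (\<lambda>t. contour_labels t @ [l]) ts"
    by (rule nth_equalityI) (auto simp: contour_labels_def)
  then show ?thesis
    by (simp add: contour_labels_def map_concat)
qed

lemma length_contour_labels [simp]: "length (contour_labels t) = length (contour t)"
  by (simp add: contour_labels_def)

lemma contour_nonempty [simp]: "contour t \<noteq> []"
  by (cases t) simp

lemma contour_nth_0: "contour t ! 0 = []"
  by (cases t) simp

lemma contour_labels_nonempty [simp]: "contour_labels t \<noteq> []"
  by (simp add: contour_labels_def)

lemma hd_contour_labels: "hd (contour_labels t) = root_label t"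
  by (cases t) (simp add: contour_labels_Node)

lemma last_contour_labels: "last (contour_labels t) = root_label t"
proof (cases t)
  case (Node l ts)
  then show ?thesis
    by (cases ts rule: rev_cases) (auto simp: contour_labels_Node)
qed

lemma is_address_contour: "p \<in> set (contour t) \<Longrightarrow> is_address t p"
proof (induction t arbitrary: p)
  case (Node l ts)
  then consider "p = []" | k q where "k < length ts" "q \<in> set (contour (ts ! k))" "p = k # q"
    by (auto simp: in_set_zip)
  then show ?case
    using Node.IH by cases auto
qed

lemma contour_labels_subset: "set (contour_labels t) \<subseteq> tree_labels t"
  by (auto simp: contour_labels_def intro: label_at_in_tree_labels is_address_contour)

text \<open>Consecutive corners of a tree belong to adjacent vertices. Only the bound on descents is
  kept, since between two trees the labels may jump upwards.\<close>

lemma successively_contour_labels: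
  "well_labeled t \<Longrightarrow> successively (\<lambda>x y. x \<le> y + 1) (contour_labels t)"
proof (induction t)
  case (Node l ts)
  have "successively (\<lambda>x y. x \<le> y + 1) (l # concat (map (\<lambda>t. contour_labels t @ [l]) us))"
    if "set us \<subseteq> set ts" for us
    using that
  proof (induction us)
    case (Cons u us)
    have u: "\<bar>root_label u - l\<bar> \<le> 1" "successively (\<lambda>x y. x \<le> y + 1) (contour_labels u)"
      using Cons.prems Node by auto
    show ?case
      using u Cons
      by (auto simp: successively_append_iff successively_Cons hd_contour_labels last_contour_labels)
  qed simp
  then show ?case
    by (simp add: contour_labels_Node)
qed

text \<open>The first index after \<open>m\<close> with value at most \<open>y\<close> is reached by
  a descent of at most 1 from a value above \<open>y\<close>, so the value there is exactly
  \<open>y\<close>.\<close>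

lemma successively_intermediate_value:
  fixes xs :: "int list"
  assumes "successively (\<lambda>x y. x \<le> y + 1) xs" "m < m'" "m' < length xs" "y < xs ! m" "xs ! m' \<le> y"
  shows "\<exists>k. m < k \<and> k \<le> m' \<and> xs ! k = y"
proof -
  define k where "k = (LEAST k. m < k \<and> xs ! k \<le> y)"
  have k: "m < k" "xs ! k \<le> y" "k \<le> m'"
    using LeastI[of "\<lambda>k. m < k \<and> xs ! k \<le> y" m'] Least_le[of "\<lambda>k. m < k \<and> xs ! k \<le> y" m'] assms
    unfolding k_def by auto
  have "y < xs ! (k - 1)"
    using not_less_Least[of "k - 1" "\<lambda>k. m < k \<and> xs ! k \<le> y"] k assms(4)
    unfolding k_def[symmetric] by (cases "k - 1 = m") auto
  moreover have "xs ! (k - 1) \<le> xs ! k + 1"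
    using assms(1,3) k(1,3) successively_nth[of _ xs "k - 1"] by auto
  ultimately show ?thesis
    using k by (intro exI[of _ k]) auto
qed

section \<open>The order of real corners\<close>

lemma corner_less_trans: "corner_less c c' \<Longrightarrow> corner_less c' c'' \<Longrightarrow> corner_less c c''"
  by (auto simp: corner_less_def)

lemma corner_less_irrefl [simp]: "\<not> corner_less c c"
  by (auto simp: corner_less_def)

lemma corner_less_linear: "corner_less c c' \<or> c = c' \<or> corner_less c' c"
  by (cases c; cases c') (auto simp: corner_less_def)

lemma finite_real_corners: "finite {c \<in> real_corners b T. i \<le> fst c \<and> fst c \<le> k}"
proof (rule finite_subset)
  show "{c \<in> real_corners b T. i \<le> fst c \<and> fst c \<le> k}
    \<subseteq> Sigma {i..k} (\<lambda>i. {..<length (contour (T i))})"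
    by (auto simp: real_corners_def)
qed auto

text \<open>Every interval of real corners is finite, so it suffices that all corners satisfying
  \<open>P\<close> lie above a fixed one.\<close>

lemma first_corner:
  assumes "c0 \<in> real_corners b T" "P c0" and low: "\<And>c. P c \<Longrightarrow> i \<le> fst c"
  defines "f \<equiv> first_corner b T P"
  shows "f \<in> real_corners b T" "P f" "\<And>c. c \<in> real_corners b T \<Longrightarrow> P c \<Longrightarrow> f = c \<or> corner_less f c"
proof -
  let ?A = "{c \<in> real_corners b T. P c \<and> fst c \<le> fst c0}"
  have fin: "finite ?A"
    using low by (auto intro: finite_subset[OF _ finite_real_corners[of b T i "fst c0"]])
  have "\<exists>m\<in>A. \<forall>c\<in>A. m = c \<or> corner_less m c"
    if "finite A" "A \<noteq> {}" for A :: "corner set"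
    using that
  proof (induction A rule: finite_ne_induct)
    case (insert x A)
    then obtain m where m: "m \<in> A" "\<forall>c\<in>A. m = c \<or> corner_less m c" by blast
    show ?case
    proof (cases "corner_less x m")
      case True
      then have "\<forall>c\<in>insert x A. x = c \<or> corner_less x c"
        using m(2) by (metis True corner_less_trans insert_iff)
      then show ?thesis by blast
    next
      case False
      then have "\<forall>c\<in>insert x A. m = c \<or> corner_less m c"
        using m(2) corner_less_linear[of x m] by auto
      then show ?thesis using m(1) by blast
    qed
  qed simp
  moreover have "?A \<noteq> {}" using assms by blast
  ultimately obtain m where m: "m \<in> ?A" "\<forall>c\<in>?A. m = c \<or> corner_less m c"
    using fin by meson
  have min: "m = c \<or> corner_less m c" if "c \<in> real_corners b T" "P c" for c
  proof (cases "fst c \<le> fst c0")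
    case True
    then show ?thesis using that m(2) by blast
  next
    case False
    then show ?thesis using m(1) by (auto simp: corner_less_def)
  qed
  have "f = m"
    unfolding f_def first_corner_def
  proof (rule the_equality)
    fix c assume c: "c \<in> real_corners b T \<and> P c \<and>
      (\<forall>c'\<in>real_corners b T. P c' \<longrightarrow> c = c' \<or> corner_less c c')"
    then show "c = m"
      using m(1) min[of c] corner_less_trans[of c m c] by auto
  qed (use m(1) min in auto)
  then show "f \<in> real_corners b T" "P f"
    "\<And>c. c \<in> real_corners b T \<Longrightarrow> P c \<Longrightarrow> f = c \<or> corner_less f c"
    using m(1) min by auto
qed

section \<open>Records, barriers and geodesic rays\<close>

locale labeled_bridge =
  fixes b :: "int \<Rightarrow> int" and T :: "int \<Rightarrow> ltree"
  assumes step: "\<And>i. b (i + 1) = b i - 1 \<or> b (i + 1) = b i + 1"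
    and tree: "\<And>i. i \<in> DS b \<Longrightarrow> well_labeled (T i) \<and> root_label (T i) = b i"
begin

abbreviation "C \<equiv> real_corners b T"
abbreviation "lab \<equiv> corner_label T"
abbreviation "sc \<equiv> succ_corner b T"
abbreviation "vert \<equiv> corner_vertex T"

definition vlab :: "vertex \<Rightarrow> int" where
  "vlab v = label_at (T (fst v)) (snd v)"

text \<open>The left end \<open>i\<close> is a parameter because records from 0 are the confluence
  points, while records from an arbitrary position guarantee that the corners there have
  successors.\<close>

definition is_record :: "int \<Rightarrow> int \<Rightarrow> bool" where
  "is_record i j \<longleftrightarrow> i \<le> j \<and> j \<in> DS b \<and> (\<forall>m\<in>{i..<j} \<inter> DS b. \<forall>l\<in>tree_labels (T m). b j < l)"

definition is_barrier :: "int \<Rightarrow> bool" where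
  "is_barrier i \<longleftrightarrow> i < 0 \<and> (\<forall>m\<in>{i..<0} \<inter> DS b. \<forall>l\<in>tree_labels (T m). b i < l)"

lemma vlab_corner_vertex [simp]: "vlab (vert c) = lab c"
  by (simp add: vlab_def corner_label_def corner_vertex_def)

lemma fst_corner_vertex [simp]: "fst (vert c) = fst c"
  by (simp add: corner_vertex_def)

lemma corner_label_nth: "c \<in> C \<Longrightarrow> lab c = contour_labels (T (fst c)) ! snd c"
  by (auto simp: corner_label_def corner_vertex_def contour_labels_def real_corners_def)

lemma corner_label_in: "c \<in> C \<Longrightarrow> lab c \<in> tree_labels (T (fst c))"
  using contour_labels_subset[of "T (fst c)"]
  by (auto simp: corner_label_nth real_corners_def)

lemma root_corner:
  assumes "i \<in> DS b"
  shows "(i, 0) \<in> C" "lab (i, 0) = b i" "vert (i, 0) = (i, [])"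
  using assms tree[OF assms]
  by (auto simp: real_corners_def corner_label_def corner_vertex_def contour_nth_0)

lemma last_root_corner:
  assumes "i \<in> DS b"
  defines "c \<equiv> (i, length (contour (T i)) - 1)"
  shows "c \<in> C" "lab c = b i"
proof -
  show c: "c \<in> C" using assms by (simp add: real_corners_def)
  have "lab c = last (contour_labels (T i))"
    unfolding corner_label_nth[OF c] by (simp add: c_def last_conv_nth)
  then show "lab c = b i" using tree[OF assms(1)] by (simp add: last_contour_labels)
qed

lemma corner_le_last: "c \<in> C \<Longrightarrow> fst c = i \<Longrightarrow> snd c \<le> length (contour (T i)) - 1"
  by (auto simp: real_corners_def)

text \<open>The walk gets below \<open>y\<close> only by a step from \<open>y\<close> to
  \<open>y - 1\<close>. This is a down-step, so the level \<open>y\<close> is attained at a real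
  vertex.\<close>

lemma walk_hits_before_descent:
  assumes "i \<le> k" "y \<le> b i" "b k < y"
  shows "\<exists>m\<in>DS b. i \<le> m \<and> m < k \<and> b m = y"
  using assms
proof (induction k rule: int_ge_induct)
  case (step k)
  show ?case
  proof (cases "b k < y")
    case True
    then show ?thesis using step by force
  next
    case False
    then have "b k = y" "k \<in> DS b"
      using labeled_bridge.step[OF labeled_bridge_axioms, of k] step by (auto simp: DS_def)
    then show ?thesis using step by auto
  qed
qed simp

lemma corner_intermediate_value_same_tree:
  assumes "(i, m) \<in> C" "(i, m') \<in> C" "m < m'" "y < lab (i, m)" "lab (i, m') \<le> y"
  shows "\<exists>c\<in>C. corner_less (i, m) c \<and> (c = (i, m') \<or> corner_less c (i, m')) \<and> lab c = y"
proof -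
  have i: "i \<in> DS b" "m' < length (contour (T i))" using assms by (auto simp: real_corners_def)
  obtain k where k: "m < k" "k \<le> m'" "contour_labels (T i) ! k = y"
    using successively_intermediate_value[OF successively_contour_labels[of "T i"], of m m' y]
      tree[OF i(1)] i(2) assms corner_label_nth[OF assms(1)] corner_label_nth[OF assms(2)] by auto
  then have "(i, k) \<in> C" using i by (auto simp: real_corners_def)
  then show ?thesis
    using k corner_label_nth[of "(i, k)"]
    by (intro bexI[of _ "(i, k)"]) (auto simp: corner_less_def)
qed

text \<open>Read from left to right, the labels of the real corners decrease by at most \<open>1\<close> at a time,
  although they may jump upwards between consecutive trees.\<close>

lemma corner_intermediate_value:
  assumes "c \<in> C" "c' \<in> C" "corner_less c c'" "y < lab c" "lab c' \<le> y"
  shows "\<exists>d\<in>C. corner_less c d \<and> (d = c' \<or> corner_less d c') \<and> lab d = y"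
proof -
  obtain i m i' m' where c: "c = (i, m)" "c' = (i', m')" by (cases c; cases c')
  have i: "i \<in> DS b" "i' \<in> DS b" using assms c by (auto simp: real_corners_def)
  show ?thesis
  proof (cases "i = i'")
    case True
    then show ?thesis
      using corner_intermediate_value_same_tree[of i m m' y] assms c by (auto simp: corner_less_def)
  next
    case False
    then have less: "i < i'" using assms c by (auto simp: corner_less_def)
    \<comment> \<open>In this order, \<open>y\<close> is attained in the rest of the tree of
      \<open>c\<close>, at a root strictly between the two trees, at the root of the tree of
      \<open>c'\<close>, or further inside the tree of \<open>c'\<close>.\<close>
    consider "b i \<le> y" | "y < b i" "b i' < y" | "b i' = y" | "y < b i" "y < b i'" by linarith
    then show ?thesis
    proof cases
      case 1
      let ?m = "length (contour (T i)) - 1"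
      have "m \<noteq> ?m" using 1 last_root_corner[OF i(1)] assms c by auto
      then have "m < ?m" using corner_le_last[of c i] assms c by auto
      then show ?thesis
        using corner_intermediate_value_same_tree[of i m ?m y] last_root_corner[OF i(1)] 1 less assms c
        by (auto simp: corner_less_def)
    next
      case 2
      have "b (i + 1) = b i - 1" using i by (simp add: DS_def)
      then obtain k where "k \<in> DS b" "i + 1 \<le> k" "k < i'" "b k = y"
        using walk_hits_before_descent[of "i + 1" i' y] 2 less by auto
      then show ?thesis
        using root_corner[of k] c by (intro bexI[of _ "(k, 0)"]) (auto simp: corner_less_def)
    next
      case 3
      then show ?thesis
        using root_corner[of i'] i c less by (intro bexI[of _ "(i', 0)"]) (auto simp: corner_less_def)
    next
      case 4
      then have "m' > 0" using root_corner(2)[OF i(2)] assms c by (cases m') auto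
      then obtain d where "d \<in> C" "corner_less (i', 0) d" "d = c' \<or> corner_less d c'" "lab d = y"
        using corner_intermediate_value_same_tree[of i' 0 m' y] root_corner[OF i(2)] 4 assms c by auto
      then show ?thesis
        using less c by (intro bexI[of _ d]) (auto simp: corner_less_def)
    qed
  qed
qed

text \<open>By the intermediate value property, the first later corner with label below
  \<open>lab c\<close> has label exactly \<open>lab c - 1\<close>, so it is the successor.\<close>

lemma succ_corner_exists:
  assumes "c \<in> C" "c' \<in> C" "corner_less c c'" "lab c' < lab c"
  shows "sc c \<in> C" "corner_less c (sc c)" "lab (sc c) = lab c - 1"
    "sc c = c' \<or> corner_less (sc c) c'"
    "\<And>d. d \<in> C \<Longrightarrow> corner_less c d \<Longrightarrow> corner_less d (sc c) \<Longrightarrow> lab c \<le> lab d"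
proof -
  obtain d where d: "d \<in> C" "corner_less c d" "d = c' \<or> corner_less d c'" "lab d = lab c - 1"
    using corner_intermediate_value[of c c' "lab c - 1"] assms by auto
  let ?P = "\<lambda>c'. corner_less c c' \<and> lab c' = lab c - 1"
  have low: "\<And>e. ?P e \<Longrightarrow> fst c \<le> fst e" by (auto simp: corner_less_def)
  note f = first_corner[of d b T ?P "fst c", OF d(1) _ low, folded succ_corner_def]
  show n: "sc c \<in> C" "corner_less c (sc c)" "lab (sc c) = lab c - 1"
    using f d by auto
  have "sc c = d \<or> corner_less (sc c) d" using f(3) d by auto
  then show "sc c = c' \<or> corner_less (sc c) c'"
    using d(3) corner_less_trans by blast
  fix e assume e: "e \<in> C" "corner_less c e" "corner_less e (sc c)"
  show "lab c \<le> lab e"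
  proof (rule ccontr)
    assume "\<not> lab c \<le> lab e"
    then obtain g where g: "g \<in> C" "corner_less c g" "g = e \<or> corner_less g e" "lab g = lab c - 1"
      using corner_intermediate_value[of c e "lab c - 1"] assms e by auto
    then have "sc c = g \<or> corner_less (sc c) g" using f(3) d by auto
    then show False
      using g(3) e(3) corner_less_trans corner_less_irrefl by metis
  qed
qed

end

lemma relpow_adjacency_imp_le_graph_dist:
  "(u, v) \<in> adjacency G ^^ n \<Longrightarrow> graph_dist G u v \<le> enat n"
  unfolding graph_dist_def by (rule INF_lower) simp

lemma geodesic_ray_inj:
  assumes "geodesic_ray G \<gamma>" shows "inj \<gamma>"
proof (rule injI)
  fix i j assume "\<gamma> i = \<gamma> j"
  then have "graph_dist G (\<gamma> i) (\<gamma> j) = graph_dist G (\<gamma> i) (\<gamma> i)" by simp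
  then show "i = j" using assms by (simp add: geodesic_ray_def del: enat.inject) (simp add: zero_enat_def)
qed

text \<open>These two assumptions are all that probability has to supply. The argument inside this
  locale, up to \<open>confluence\<close>, is deterministic.\<close>

locale recurrent_labeled_bridge = labeled_bridge +
  assumes records: "infinite {j. 0 \<le> j \<and> is_record 0 j}"
    and barriers: "infinite {i. is_barrier i}"
begin

lemma record_beyond: "\<exists>j. k < j \<and> is_record 0 j"
proof (rule ccontr)
  assume "\<not> ?thesis"
  then have "{j. 0 \<le> j \<and> is_record 0 j} \<subseteq> {0..k}" by (auto simp: not_less)
  then show False using records finite_subset by blast
qed

lemma barrier_beyond: "\<exists>i. i < k \<and> is_barrier i"
proof (rule ccontr)
  assume "\<not> ?thesis"
  then have "{i. is_barrier i} \<subseteq> {k..0}" by (force simp: not_less is_barrier_def)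
  then show False using barriers finite_subset by blast
qed

lemma records_decrease: "is_record 0 j \<Longrightarrow> is_record 0 j' \<Longrightarrow> j < j' \<Longrightarrow> b j' < b j"
  using tree[of j] root_label_in_tree_labels[of "T j"] by (auto simp: is_record_def)

lemma record_below: "\<exists>j. k < j \<and> is_record 0 j \<and> b j < y"
proof -
  obtain j0 where j0: "k < j0" "is_record 0 j0" using record_beyond by blast
  have "\<exists>j. k < j \<and> is_record 0 j \<and> b j \<le> b j0 - int n" for n
  proof (induction n)
    case (Suc n)
    then obtain j where j: "k < j" "is_record 0 j" "b j \<le> b j0 - int n" by blast
    obtain j' where j': "j < j'" "is_record 0 j'" using record_beyond by blast
    then have "b j' < b j" using j records_decrease by blast
    then show ?case using j j' by (intro exI[of _ j']) auto
  qed (use j0 in auto)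
  then obtain j where "k < j" "is_record 0 j" "b j \<le> b j0 - int (nat (b j0 - y + 1))" by blast
  then show ?thesis by (intro exI[of _ j]) (auto split: if_splits)
qed

text \<open>Left of 0 only finitely many labels lie in the trees on \<open>[i, 0)\<close>, and the
  labels of records from 0 decrease without bound, so late records from 0 are records from
  \<open>i\<close>.\<close>

lemma record_from: "\<exists>j. i < j \<and> 0 \<le> j \<and> is_record i j"
proof -
  let ?L = "\<Union>m\<in>{i..<0} \<inter> DS b. tree_labels (T m)"
  have fin: "finite ?L" by (auto intro: finite_tree_labels)
  obtain y where y: "\<And>l. l \<in> ?L \<Longrightarrow> y \<le> l"
    using finite_has_minimal[of "insert 0 ?L"] fin by (meson Min_le)
  obtain j where "max i 0 < j" "is_record 0 j" "b j < y" using record_below by blast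
  then show ?thesis
    using y by (intro exI[of _ j]) (force simp: is_record_def)
qed

lemma succ_corner_props:
  assumes c: "c \<in> C"
  shows "sc c \<in> C" "corner_less c (sc c)" "lab (sc c) = lab c - 1"
    "\<And>d. d \<in> C \<Longrightarrow> corner_less c d \<Longrightarrow> corner_less d (sc c) \<Longrightarrow> lab c \<le> lab d"
proof -
  obtain j where j: "fst c < j" "is_record (fst c) j" using record_from by blast
  then have "j \<in> DS b" "fst c \<in> DS b" using c by (auto simp: is_record_def real_corners_def)
  note r = root_corner[OF this(1)]
  have "b j < lab c"
    using j corner_label_in[OF c] \<open>fst c \<in> DS b\<close> by (auto simp: is_record_def)
  then show "sc c \<in> C" "corner_less c (sc c)" "lab (sc c) = lab c - 1"
    "\<And>d. d \<in> C \<Longrightarrow> corner_less c d \<Longrightarrow> corner_less d (sc c) \<Longrightarrow> lab c \<le> lab d"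
    using succ_corner_exists[OF c r(1)] r j by (auto simp: corner_less_def)
qed

lemma sc_le:
  assumes "c \<in> C" "d \<in> C" "corner_less c d" "lab d < lab c"
  shows "sc c = d \<or> corner_less (sc c) d"
  using succ_corner_exists[OF assms] by blast

lemma fst_sc: "c \<in> C \<Longrightarrow> fst c \<le> fst (sc c)"
  using succ_corner_props(2)[of c] by (auto simp: corner_less_def)

abbreviation "Q \<equiv> uihpq b T"

lemma adjacency_iff:
  "(u, v) \<in> adjacency Q \<longleftrightarrow>
    (\<exists>c\<in>C. u = vert c \<and> v = vert (sc c) \<or> v = vert c \<and> u = vert (sc c))"
  by (auto simp: adjacency_def arcs_ends_def arc_to_ends_def uihpq_def)

lemma adjacencyE:
  assumes "(u, v) \<in> adjacency Q"
  obtains (down) c where "c \<in> C" "u = vert c" "v = vert (sc c)" "vlab v = vlab u - 1" "fst u \<le> fst v"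
    | (up) c where "c \<in> C" "v = vert c" "u = vert (sc c)" "vlab v = vlab u + 1" "fst v \<le> fst u"
proof -
  obtain c where c: "c \<in> C" "u = vert c \<and> v = vert (sc c) \<or> v = vert c \<and> u = vert (sc c)"
    using assms adjacency_iff by auto
  show thesis
    using c(2) down[of c] up[of c] c(1) succ_corner_props(3)[OF c(1)] fst_sc[OF c(1)] by auto
qed

text \<open>The chain of successors from \<open>c\<close> cannot jump over \<open>e\<close>, since
  \<open>e\<close> has a smaller label than every corner passed before it. The chain loses one level
  per step, so it ends exactly in \<open>e\<close>.\<close>

lemma descending_path:
  assumes "c \<in> C" "e \<in> C" "c = e \<or> corner_less c e"
    and "\<And>d. d \<in> C \<Longrightarrow> d = c \<or> corner_less c d \<Longrightarrow> corner_less d e \<Longrightarrow> lab e < lab d"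
  shows "(vert c, vert e) \<in> adjacency Q ^^ nat (lab c - lab e)"
  using assms
proof (induction "nat (lab c - lab e)" arbitrary: c)
  case 0
  then have "c = e" using "0.prems" "0.prems"(4)[of c] by fastforce
  then show ?case by simp
next
  case (Suc n)
  then have less: "corner_less c e" "lab e < lab c" by auto
  note s = succ_corner_props[OF Suc.prems(1)]
  have le: "sc c = e \<or> corner_less (sc c) e"
    using sc_le[OF Suc.prems(1,2) less] .
  have "(vert (sc c), vert e) \<in> adjacency Q ^^ nat (lab (sc c) - lab e)"
  proof (rule Suc.hyps(1))
    show "n = nat (lab (sc c) - lab e)" using Suc.hyps(2) s(3) by simp
    fix d assume "d \<in> C" "d = sc c \<or> corner_less (sc c) d" "corner_less d e"
    then show "lab e < lab d" using Suc.prems(4) s(2) corner_less_trans by blast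
  qed (rule s(1) Suc.prems(2) le)+
  moreover have "(vert c, vert (sc c)) \<in> adjacency Q"
    using Suc.prems(1) adjacency_iff by blast
  moreover have "nat (lab c - lab e) = Suc (nat (lab (sc c) - lab e))"
    using less s(3) by simp
  ultimately show ?case
    by (metis relpow_Suc_I2)
qed

text \<open>Arcs lead to the right. One that starts in \<open>[0, j)\<close> has label above
  \<open>b j\<close> there, so its end comes no later than the first root corner
  \<open>(j, 0)\<close>.\<close>

lemma record_cut:
  assumes j: "is_record 0 j" and uv: "(u, v) \<in> adjacency Q"
    and u: "0 \<le> fst u" "fst u < j" and v: "j \<le> fst v"
  shows "v = (j, [])"
  using uv
proof (cases rule: adjacencyE)
  case (down c)
  have jD: "j \<in> DS b" using j by (simp add: is_record_def)
  note r = root_corner[OF jD]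
  have "b j < lab c"
    using j u down corner_label_in[of c] by (auto simp: is_record_def real_corners_def)
  then have "sc c = (j, 0) \<or> corner_less (sc c) (j, 0)"
    using down u r by (intro sc_le) (auto simp: corner_less_def)
  then show ?thesis
    using down v r by (auto simp: corner_less_def)
next
  case (up c)
  then show ?thesis using u v by simp
qed

text \<open>Let \<open>k\<close> be the last down-step before \<open>i\<close>. From
  \<open>k + 1\<close> to \<open>i\<close> the walk only rises, so \<open>b k - 1 \<le> b i\<close>.
  An arc from the left passing over the last corner of the tree at \<open>k\<close> has start label
  at most \<open>b k\<close>, hence end label at most \<open>b i\<close>, and no such label occurs
  on \<open>[i, 0)\<close>.\<close>

lemma barrier_cut:
  assumes i: "is_barrier i" and uv: "(u, v) \<in> adjacency Q"
    and u: "fst u < i" and v: "i \<le> fst v"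
  shows "0 \<le> fst v"
  using uv
proof (cases rule: adjacencyE)
  case (down c)
  let ?D = "{fst c..<i} \<inter> DS b"
  define k where "k = Max ?D"
  have "fst c \<in> ?D" using down u by (auto simp: real_corners_def)
  then have "k \<in> ?D" "fst c \<le> k"
    unfolding k_def using Max_in[of ?D] Max_ge[of ?D "fst c"] by blast+
  then have k: "k \<in> DS b" "k < i" "fst c \<le> k" by auto
  have last: "m \<notin> DS b" if "k < m" "m < i" for m
  proof
    assume "m \<in> DS b"
    then have "m \<in> ?D" using that k by auto
    then have "m \<le> k" unfolding k_def by (intro Max_ge) auto
    then show False using that by simp
  qed
  have "b (k + 1) \<le> b i"
    using k(2) last
  proof (induction i rule: int_gr_induct)
    case (step i)
    then have "i \<notin> DS b" by auto
    then have "b (i + 1) = b i + 1" using labeled_bridge.step[OF labeled_bridge_axioms, of i] by (auto simp: DS_def)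
    then show ?case using step by auto
  qed simp
  then have bk: "b k - 1 \<le> b i" using k(1) by (simp add: DS_def)
  let ?e = "(k, length (contour (T k)) - 1)"
  note e = last_root_corner[OF k(1)]
  have "lab c \<le> b k"
  proof (cases "c = ?e")
    case False
    then have "corner_less c ?e"
      using corner_le_last[OF down(1), of k] k(3) by (cases c) (auto simp: corner_less_def)
    moreover have "corner_less ?e (sc c)"
      using down v k by (auto simp: corner_less_def)
    ultimately show ?thesis using succ_corner_props(4)[OF down(1) e(1)] e(2) by simp
  qed (use e(2) in simp)
  then have "lab (sc c) \<le> b i" using succ_corner_props(3)[OF down(1)] bk by simp
  moreover have "b i < lab (sc c)" if "fst (sc c) < 0"
    using i that down v corner_label_in[OF succ_corner_props(1)[OF down(1)]] succ_corner_props(1)[OF down(1)]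
    by (auto simp: is_barrier_def real_corners_def)
  ultimately show ?thesis using down by fastforce
next
  case (up c)
  then show ?thesis using u v by simp
qed

lemma finite_real_vertices: "finite {v \<in> real_vertices b T. i \<le> fst v \<and> fst v \<le> k}"
proof (rule finite_subset)
  have fin: "finite {p. is_address t p}" for t
  proof (induction t)
    case (Node l ts)
    have "{p. is_address (Node l ts) p} \<subseteq>
        insert [] (\<Union>n\<in>{..<length ts}. Cons n ` {p. is_address (ts ! n) p})" (is "_ \<subseteq> ?A")
    proof
      fix p assume "p \<in> {p. is_address (Node l ts) p}"
      then show "p \<in> ?A" by (cases p) auto
    qed
    moreover have "finite ?A" using Node by auto
    ultimately show ?case by (rule finite_subset)
  qed
  show "{v \<in> real_vertices b T. i \<le> fst v \<and> fst v \<le> k} \<subseteq> Sigma {i..k} (\<lambda>i. {p. is_address (T i) p})"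
    by (auto simp: real_vertices_def)
  show "finite (Sigma {i..k} (\<lambda>i. {p. is_address (T i) p}))"
    using fin by auto
qed

section \<open>The course of a fixed geodesic ray\<close>

context
  fixes \<gamma> assumes ray: "geodesic_ray Q \<gamma>"
begin

lemma ray_adj: "(\<gamma> n, \<gamma> (Suc n)) \<in> adjacency Q"
  using ray by (simp add: geodesic_ray_def)

lemma ray_escapes: "finite {n. i \<le> fst (\<gamma> n) \<and> fst (\<gamma> n) \<le> k}"
proof (rule inj_on_finite[where f = \<gamma>])
  show "inj_on \<gamma> {n. i \<le> fst (\<gamma> n) \<and> fst (\<gamma> n) \<le> k}"
    using geodesic_ray_inj[OF ray] inj_on_subset by blast
  show "\<gamma> ` {n. i \<le> fst (\<gamma> n) \<and> fst (\<gamma> n) \<le> k} \<subseteq> {v \<in> real_vertices b T. i \<le> fst v \<and> fst v \<le> k}"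
    using ray by (auto simp: geodesic_ray_def uihpq_def)
qed (rule finite_real_vertices)

lemma ray_escapes_after: "\<exists>n\<ge>N. \<not> (i \<le> fst (\<gamma> n) \<and> fst (\<gamma> n) \<le> k)"
proof (rule ccontr)
  assume "\<not> ?thesis"
  then have "{N..} \<subseteq> {n. i \<le> fst (\<gamma> n) \<and> fst (\<gamma> n) \<le> k}" by auto
  then show False using ray_escapes infinite_Ici finite_subset by blast
qed

lemma ray_right_infinitely_often: "\<exists>n\<ge>N. 0 \<le> fst (\<gamma> n)"
proof (rule ccontr)
  assume "\<not> ?thesis"
  then have left: "fst (\<gamma> n) < 0" if "n \<ge> N" for n using that by (meson not_le)
  obtain i where i: "i < fst (\<gamma> N)" "is_barrier i" using barrier_beyond by blast
  have "i \<le> fst (\<gamma> n)" if "n \<ge> N" for n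
    using that
  proof (induction n rule: dec_induct)
    case (step n)
    show ?case
    proof (rule ccontr)
      assume less: "\<not> i \<le> fst (\<gamma> (Suc n))"
      \<comment> \<open>Reversed, an edge leaving \<open>[i, 0)\<close> to the left would enter it
        from the left of the barrier.\<close>
      have "(\<gamma> (Suc n), \<gamma> n) \<in> adjacency Q"
        using ray_adj[of n] by (auto simp: adjacency_def)
      then show False
        using barrier_cut[OF i(2), of "\<gamma> (Suc n)" "\<gamma> n"] left[of n] less step by auto
    qed
  qed (use i in simp)
  then show False using ray_escapes_after[of N i 0] left by (meson less_imp_le)
qed

lemma ray_label_ge: "vlab (\<gamma> 0) - int n \<le> vlab (\<gamma> n)"
proof (induction n)
  case (Suc n)
  from ray_adj[of n] show ?case
    by (cases rule: adjacencyE) (use Suc in auto)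
qed simp

text \<open>A step lowers the label by at most 1, so losing \<open>n\<close> levels in
  \<open>n\<close> steps forces every step to follow an arc forwards, that is, weakly to the
  right.\<close>

lemma ray_monotone_of_descending:
  assumes "vlab (\<gamma> n) = vlab (\<gamma> 0) - int n" "m < n"
  shows "vlab (\<gamma> m) = vlab (\<gamma> 0) - int m" and "fst (\<gamma> m) \<le> fst (\<gamma> (Suc m))"
proof -
  have *: "vlab (\<gamma> m) = vlab (\<gamma> 0) - int m" if "m \<le> n" for m
    using that
  proof (induction m rule: inc_induct)
    case (step m)
    have "vlab (\<gamma> (Suc m)) = vlab (\<gamma> 0) - int (Suc m)" by (rule step)
    with ray_adj[of m] ray_label_ge[of m] show ?case
      by (auto elim!: adjacencyE)
  qed (use assms in simp)
  show "vlab (\<gamma> m) = vlab (\<gamma> 0) - int m" using *[of m] assms(2) by simp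
  have eq: "vlab (\<gamma> (Suc m)) = vlab (\<gamma> m) - 1" using *[of m] *[of "Suc m"] assms(2) by simp
  from ray_adj[of m] show "fst (\<gamma> m) \<le> fst (\<gamma> (Suc m))"
    by (cases rule: adjacencyE) (use eq in simp_all)
qed

text \<open>If the ray crossed from left to right infinitely often, then each crossing would end at the
  first corner with its label right of \<open>0\<close>, which is reached from \<open>\<gamma> 0\<close> by descending at each step.
  Such a path never moves to the left.\<close>

lemma ray_eventually_right: "\<exists>N. \<forall>n\<ge>N. 0 \<le> fst (\<gamma> n)"
proof (rule ccontr)
  assume "\<not> ?thesis"
  then have left: "\<exists>n\<ge>N. fst (\<gamma> n) < 0" for N by (meson not_le)
  have cross: "\<exists>n\<ge>N. fst (\<gamma> n) < 0 \<and> 0 \<le> fst (\<gamma> (Suc n))" for N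
  proof -
    obtain n where n: "n \<ge> N" "fst (\<gamma> n) < 0" using left by blast
    obtain n' where n': "n' \<ge> n" "0 \<le> fst (\<gamma> n')" using ray_right_infinitely_often by blast
    from n'(1,2) have "\<exists>k\<ge>n. fst (\<gamma> k) < 0 \<and> 0 \<le> fst (\<gamma> (Suc k))"
    proof (induction n' rule: dec_induct)
      case (step k)
      then show ?case by (cases "0 \<le> fst (\<gamma> k)") (auto simp: not_le)
    qed (use n in auto)
    then show ?thesis using n(1) le_trans by blast
  qed
  obtain c0 where c0: "c0 \<in> C" "\<gamma> 0 = vert c0"
    using ray_adj[of 0] by (cases rule: adjacencyE) (use that succ_corner_props(1) in blast)+
  \<comment> \<open>Corners from \<open>c0\<close> up to position \<open>j\<close> have labels above
    \<open>b j\<close>, whereas an arc jumping over \<open>(j, 0)\<close> ends below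
    \<open>b j\<close>. So the end of such an arc lies below all corners from \<open>c0\<close> up
    to it, as \<open>descending_path\<close> requires.\<close>
  obtain j where j: "fst c0 < j" "0 \<le> j" "is_record (fst c0) j" using record_from by blast
  have jD: "j \<in> DS b" using j by (simp add: is_record_def)
  note r = root_corner[OF jD]
  have descends: "\<exists>n\<ge>N. vlab (\<gamma> n) = vlab (\<gamma> 0) - int n" for N
  proof -
    \<comment> \<open>After time \<open>N'\<close> the ray avoids the positions from 0 to
      \<open>j\<close>, so a crossing of the origin must land beyond \<open>j\<close>.\<close>
    obtain N' where N': "\<forall>n\<in>{n. 0 \<le> fst (\<gamma> n) \<and> fst (\<gamma> n) \<le> j}. n < N'"
      using ray_escapes[of 0 j] unfolding finite_nat_set_iff_bounded by blast
    obtain n where n: "n \<ge> max N N'" "fst (\<gamma> n) < 0" "0 \<le> fst (\<gamma> (Suc n))" using cross by blast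
    then have jn: "j < fst (\<gamma> (Suc n))" using N' by fastforce
    from ray_adj[of n] obtain c where c: "c \<in> C" "\<gamma> n = vert c" "\<gamma> (Suc n) = vert (sc c)"
      by (cases rule: adjacencyE) (use n in auto)
    have cr: "corner_less c (j, 0)" "corner_less (j, 0) (sc c)" "corner_less c0 (j, 0)"
      using n j jn c by (auto simp: corner_less_def)
    have low: "lab (sc c) < lab d" if "d \<in> C" "corner_less c d" "corner_less d (sc c)" for d
      using succ_corner_props(3)[OF c(1)] succ_corner_props(4)[OF c(1) that] by simp
    have "(vert c0, vert (sc c)) \<in> adjacency Q ^^ nat (lab c0 - lab (sc c))"
    proof (rule descending_path)
      show "c0 = sc c \<or> corner_less c0 (sc c)" using cr corner_less_trans by blast
      fix d assume d: "d \<in> C" "d = c0 \<or> corner_less c0 d" "corner_less d (sc c)"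
      show "lab (sc c) < lab d"
      proof (cases "corner_less c d")
        case True
        then show ?thesis using low d by blast
      next
        case False
        then have "fst d < j" "fst c0 \<le> fst d" "fst d \<in> DS b"
          using d n(2) c(2) j(2) by (auto simp: corner_less_def real_corners_def)
        then have "b j < lab d" using j(3) corner_label_in[OF d(1)] by (auto simp: is_record_def)
        moreover have "lab (sc c) < b j" using low[OF r(1)] r(2) cr by simp
        ultimately show ?thesis by simp
      qed
    qed (rule c0(1) succ_corner_props(1)[OF c(1)])+
    then have "graph_dist Q (\<gamma> 0) (\<gamma> (Suc n)) \<le> enat (nat (lab c0 - lab (sc c)))"
      using relpow_adjacency_imp_le_graph_dist c0 c(3) by simp
    moreover have "graph_dist Q (\<gamma> 0) (\<gamma> (Suc n)) = enat (Suc n)"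
      using ray unfolding geodesic_ray_def by simp
    ultimately have "enat (Suc n) \<le> enat (nat (lab c0 - lab (sc c)))" by simp
    then have "vlab (\<gamma> (Suc n)) \<le> vlab (\<gamma> 0) - int (Suc n)" using c0 c(3) by simp
    then show ?thesis
      using ray_label_ge[of "Suc n"] n(1) by (intro exI[of _ "Suc n"]) auto
  qed
  have mono: "fst (\<gamma> n) \<le> fst (\<gamma> (Suc n))" for n
    using descends[of "Suc n"] ray_monotone_of_descending(2) Suc_le_lessD by blast
  obtain n where n: "0 \<le> fst (\<gamma> n)" using ray_right_infinitely_often by blast
  obtain n' where "n' \<ge> n" "fst (\<gamma> n') < 0" using left by blast
  moreover from this(1) have "fst (\<gamma> n) \<le> fst (\<gamma> n')"
    by (rule lift_Suc_mono_le[of "\<lambda>n. fst (\<gamma> n)", OF mono])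
  ultimately show False using n by simp
qed

text \<open>Once the ray stays on the right half-line, it must still leave \<open>[0, j)\<close> for
  every record \<open>j\<close> beyond its current position, and \<open>record_cut\<close> makes it
  land on \<open>j\<close>.\<close>

lemma ray_hits_records: "finite {j. is_record 0 j \<and> (j, []) \<notin> range \<gamma>}"
proof -
  obtain N where N: "\<And>n. n \<ge> N \<Longrightarrow> 0 \<le> fst (\<gamma> n)" using ray_eventually_right by blast
  have "(j, []) \<in> range \<gamma>" if j: "is_record 0 j" "fst (\<gamma> N) < j" for j
  proof -
    obtain n where n: "n \<ge> N" "j \<le> fst (\<gamma> n)"
      using ray_escapes_after[of N 0 j] N by (meson linear)
    then show ?thesis
    proof (induction n rule: dec_induct)
      case (step n)
      show ?case
      proof (cases "j \<le> fst (\<gamma> n)")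
        case False
        then have "\<gamma> (Suc n) = (j, [])"
          using record_cut[OF j(1) ray_adj[of n]] N[of n] step by auto
        then show ?thesis by (metis rangeI)
      qed (use step in simp)
    qed (use j in simp)
  qed
  then have "{j. is_record 0 j \<and> (j, []) \<notin> range \<gamma>} \<subseteq> {0..fst (\<gamma> N)}"
    by (force simp: is_record_def)
  then show ?thesis using finite_subset by blast
qed

lemma ray_hits_boundary: "infinite {n. \<gamma> n \<in> boundary b T}"
proof
  assume fin: "finite {n. \<gamma> n \<in> boundary b T}"
  let ?S = "{j. 0 \<le> j \<and> is_record 0 j \<and> (j, []) \<in> range \<gamma>}"
  have "{j. 0 \<le> j \<and> is_record 0 j} - {j. is_record 0 j \<and> (j, []) \<notin> range \<gamma>} \<subseteq> ?S" by auto
  then have "infinite ?S"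
    using records ray_hits_records by (meson Diff_infinite_finite finite_subset)
  moreover have "?S \<subseteq> (fst \<circ> \<gamma>) ` {n. \<gamma> n \<in> boundary b T}"
  proof
    fix j assume "j \<in> ?S"
    then obtain n where n: "\<gamma> n = (j, [])" "j \<in> DS b" by (auto simp: is_record_def)
    then have "\<gamma> n = \<phi> b T j" by (simp add: boundary_vertex_def)
    then have "\<gamma> n \<in> boundary b T" by (simp add: boundary_def)
    then show "j \<in> (fst \<circ> \<gamma>) ` {n. \<gamma> n \<in> boundary b T}"
      using n(1) by (intro image_eqI[of _ _ n]) simp_all
  qed
  ultimately show False using fin finite_surj by blast
qed

end

theorem confluence:
  "\<exists>v :: nat \<Rightarrow> vertex. inj v \<and> range v \<subseteq> boundary b T \<and>
     (\<forall>\<gamma>. geodesic_ray Q \<gamma> \<longrightarrow> finite {k. v k \<notin> range \<gamma>})"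
proof -
  let ?S = "{j. 0 \<le> j \<and> is_record 0 j}"
  obtain e :: "nat \<Rightarrow> int" where e: "inj e" "range e \<subseteq> ?S"
    using infinite_countable_subset[OF records] by blast
  have "(e k, []) = \<phi> b T (e k)" for k
    using e(2) by (auto simp: boundary_vertex_def is_record_def)
  then have "range (\<lambda>k. (e k, [])) \<subseteq> boundary b T" by (auto simp: boundary_def)
  moreover have "finite {k. (e k, []) \<notin> range \<gamma>}" if "geodesic_ray Q \<gamma>" for \<gamma>
  proof (rule inj_on_finite[where f = e])
    show "e ` {k. (e k, []) \<notin> range \<gamma>} \<subseteq> {j. is_record 0 j \<and> (j, []) \<notin> range \<gamma>}"
      using e(2) by auto
    show "inj_on e {k. (e k, []) \<notin> range \<gamma>}" using e(1) inj_on_subset by blast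
  qed (rule ray_hits_records[OF that])
  moreover have "inj (\<lambda>k. (e k, []))" using e(1) by (auto simp: inj_def)
  ultimately show ?thesis by blast
qed

end

section \<open>The law of the smallest label\<close>

text \<open>Shifting labels maps the laws \<open>\<rho> k\<close> to one another. It normalises all
  trees of the bridge to root label 0.\<close>

primrec shift_tree :: "int \<Rightarrow> ltree \<Rightarrow> ltree" where
  "shift_tree k (Node l ts) = Node (l + k) (map (shift_tree k) ts)"

lemma shift_tree_shift_tree [simp]: "shift_tree k (shift_tree k' t) = shift_tree (k + k') t"
  by (induction t) auto

lemma shift_tree_0 [simp]: "shift_tree 0 t = t"
  by (induction t) (auto intro: map_idI)

lemma bij_shift_tree: "bij (shift_tree k)"
  by (rule bij_betw_byWitness[of _ "shift_tree (- k)"]) auto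

lemma root_label_shift_tree [simp]: "root_label (shift_tree k t) = root_label t + k"
  by (cases t) simp

lemma num_edges_shift_tree [simp]: "num_edges (shift_tree k t) = num_edges t"
  by (induction t) (auto simp: o_def intro!: arg_cong[of _ _ sum_list] map_cong)

lemma well_labeled_shift_tree [simp]: "well_labeled (shift_tree k t) \<longleftrightarrow> well_labeled t"
  by (induction t) auto

lemma tree_labels_shift_tree: "tree_labels (shift_tree k t) = (\<lambda>l. l + k) ` tree_labels t"
  by (induction t) auto

text \<open>One weight for all root labels, of which each \<open>\<rho> k\<close> is a restriction.
  The three possible root labels of a child can thus be summed together.\<close>

definition tree_weight :: "ltree \<Rightarrow> ennreal" where
  "tree_weight t = (if well_labeled t then ennreal (1/2 * (1/12) ^ num_edges t) else 0)"

lemma emeasure_tree_law: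
  "emeasure (\<rho> k) A =
    (\<integral>\<^sup>+t. tree_weight t * indicator {t. root_label t = k \<and> t \<in> A} t \<partial>count_space UNIV)"
  unfolding tree_law_def
  by (subst emeasure_density) (auto intro!: nn_integral_cong simp: tree_weight_def indicator_def)

lemma emeasure_tree_law_shift: "emeasure (\<rho> (k + m)) A = emeasure (\<rho> k) (shift_tree m -` A)"
  unfolding emeasure_tree_law
  by (subst nn_integral_bij_count_space[OF bij_shift_tree[of m], symmetric])
    (auto intro!: nn_integral_cong simp: tree_weight_def indicator_def)

lemma nn_integral_count_space_list:
  "(\<integral>\<^sup>+xs. F xs \<partial>count_space UNIV) =
    F [] + (\<integral>\<^sup>+x. (\<integral>\<^sup>+xs. F (x # xs) \<partial>count_space UNIV) \<partial>count_space UNIV)"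
proof -
  have U: "UNIV = {[]} \<union> range (\<lambda>(x, xs). x # xs :: 'a list)"
    by (auto simp: image_iff) (metis list.exhaust)
  have bij: "bij_betw (\<lambda>(x, xs). x # xs :: 'a list) UNIV (range (\<lambda>(x, xs). x # xs))"
    by (auto simp: bij_betw_def inj_on_def)
  have "(\<integral>\<^sup>+xs. F xs \<partial>count_space UNIV) =
    (\<integral>\<^sup>+xs. F xs * indicator {[]} xs + F xs * indicator (range (\<lambda>(x, xs). x # xs)) xs \<partial>count_space UNIV)"
  proof (rule nn_integral_cong)
    fix xs :: "'a list"
    show "F xs = F xs * indicator {[]} xs + F xs * indicator (range (\<lambda>(x, xs). x # xs)) xs"
      by (cases xs) (auto simp: indicator_def image_iff)
  qed
  also have "\<dots> = (\<integral>\<^sup>+xs. F xs * indicator {[]} xs \<partial>count_space UNIV)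
      + (\<integral>\<^sup>+xs. F xs * indicator (range (\<lambda>(x, xs). x # xs)) xs \<partial>count_space UNIV)"
    by (rule nn_integral_add) auto
  also have "(\<integral>\<^sup>+xs. F xs * indicator {[]} xs \<partial>count_space UNIV) = F []"
    by (simp add: nn_integral_count_space_indicator[symmetric] nn_integral_count_space_finite)
  also have "(\<integral>\<^sup>+xs. F xs * indicator (range (\<lambda>(x, xs). x # xs)) xs \<partial>count_space UNIV)
     = (\<integral>\<^sup>+xs. F xs \<partial>count_space (range (\<lambda>(x, xs). x # xs)))"
    by (subst (2) nn_integral_count_space_indicator) simp_all
  also have "\<dots> = (\<integral>\<^sup>+z. F ((\<lambda>(x, xs). x # xs) z) \<partial>count_space UNIV)"
    by (rule nn_integral_bij_count_space[OF bij, symmetric])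
  also have "\<dots> = (\<integral>\<^sup>+z. F (fst z # snd z) \<partial>count_space UNIV)"
    by (simp add: case_prod_beta)
  also have "\<dots> = (\<integral>\<^sup>+x. (\<integral>\<^sup>+xs. F (x # xs) \<partial>count_space UNIV) \<partial>count_space UNIV)"
    by (subst nn_integral_fst_count_space[symmetric]) simp
  finally show ?thesis .
qed

text \<open>Truncating at height \<open>h\<close> replaces the fixed-point equation for the
  probability of a positive tree by a recursion in \<open>h\<close>.\<close>

fun positive_upto :: "nat \<Rightarrow> ltree \<Rightarrow> bool" where
  "positive_upto 0 (Node l ts) \<longleftrightarrow> 0 < l"
| "positive_upto (Suc h) (Node l ts) \<longleftrightarrow> 0 < l \<and> (\<forall>t\<in>set ts. positive_upto h t)"

lemma positive_upto_0: "positive_upto 0 t \<longleftrightarrow> 0 < root_label t"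
  by (cases t) simp

lemma positive_upto_Suc: "positive_upto (Suc h) t \<Longrightarrow> positive_upto h t"
proof (induction h arbitrary: t)
  case 0 then show ?case by (cases t) simp
next
  case (Suc h) then show ?case by (cases t) auto
qed

lemma tree_labels_positive:
  assumes "\<And>h. positive_upto h t" "l \<in> tree_labels t"
  shows "0 < l"
  using assms
proof (induction t)
  case (Node r ts)
  have "0 < r" using Node.prems(1)[of 0] by simp
  moreover have "positive_upto h t" if "t \<in> set ts" for h t
    using Node.prems(1)[of "Suc h"] that by simp
  ultimately show ?case using Node.IH Node.prems(2) by auto
qed

text \<open>A tree of law \<open>\<rho> k\<close> is a Galton--Watson tree with geometric offspring, whose
  subtrees have a uniform root label in \<open>{k - 1, k, k + 1}\<close>.\<close>

lemma tree_law_step: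
  fixes P :: "ltree \<Rightarrow> bool" and k :: int
  defines "s \<equiv> emeasure (\<rho> k) {t. \<forall>u\<in>set (children t). P u}"
  shows "s = 1/2 + (emeasure (\<rho> (k - 1)) {t. P t} + emeasure (\<rho> k) {t. P t}
                + emeasure (\<rho> (k + 1)) {t. P t}) / 6 * s"
proof -
  \<comment> \<open>Dividing by 6 turns the factor \<open>1/2\<close> in the law of the child into
    the weight \<open>1/12\<close> of the edge leading to it.\<close>
  define g where "g t = (if \<bar>root_label t - k\<bar> \<le> 1 \<and> P t then tree_weight t / 6 else 0)" for t
  have edge: "ennreal (1/2 * (1/12) ^ n) / 6 = ennreal ((1/12) ^ Suc n)" for n :: nat
  proof -
    have "ennreal (1/2 * (1/12) ^ n) / 6 = ennreal (1/2 * (1/12) ^ n / 6)"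
      by (rule ennreal_divide_numeral) simp
    also have "1/2 * (1/12) ^ n / 6 = ((1/12) ^ Suc n :: real)" by simp
    finally show ?thesis .
  qed
  have half: "(1/2 :: ennreal) = ennreal (1/2)"
    by (metis ennreal_1 ennreal_divide_numeral zero_le_one)
  have prod: "prod_list (map g ts) =
      (if \<forall>u\<in>set ts. \<bar>root_label u - k\<bar> \<le> 1 \<and> P u \<and> well_labeled u
       then ennreal ((1/12) ^ (\<Sum>u\<leftarrow>ts. Suc (num_edges u))) else 0)" for ts
  proof (induction ts)
    case (Cons u ts)
    have "g u = (if \<bar>root_label u - k\<bar> \<le> 1 \<and> P u \<and> well_labeled u
        then ennreal ((1/12) ^ Suc (num_edges u)) else 0)"
      using edge[of "num_edges u"] by (simp only: g_def tree_weight_def split: if_split) auto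
    then show ?case
      using Cons by (auto simp: power_add ac_simps simp flip: ennreal_mult)
  qed simp
  have weight: "tree_weight (Node k ts) * indicator {t. \<forall>u\<in>set (children t). P u} (Node k ts)
      = 1/2 * prod_list (map g ts)" for ts
  proof -
    have "ennreal (1/2 * (1/12) ^ n) = ennreal (1/2) * ennreal ((1/12) ^ n)" for n :: nat
      by (rule ennreal_mult) simp_all
    then show ?thesis
      unfolding prod half by (simp only: tree_weight_def indicator_def split: if_split) auto
  qed
  define L where "L = (\<integral>\<^sup>+ts. prod_list (map g ts) \<partial>count_space UNIV)"
  have bij: "bij_betw (Node k) UNIV {t. root_label t = k}"
    by (rule bij_betw_byWitness[of _ children]) auto
  have "s = (\<integral>\<^sup>+t. tree_weight t * indicator {t. \<forall>u\<in>set (children t). P u} t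
              \<partial>count_space {t. root_label t = k})"
    unfolding s_def emeasure_tree_law
    by (subst nn_integral_count_space_indicator)
      (auto intro!: nn_integral_cong simp: indicator_def)
  also have "\<dots> = (\<integral>\<^sup>+ts. 1/2 * prod_list (map g ts) \<partial>count_space UNIV)"
    unfolding nn_integral_bij_count_space[OF bij, symmetric] weight ..
  also have "\<dots> = 1/2 * L"
    unfolding L_def by (rule nn_integral_cmult) simp
  finally have s: "s = 1/2 * L" .
  \<comment> \<open>Splitting off the first child from the list of children. In
    \<open>ennreal\<close> this holds whether or not \<open>L\<close> is finite.\<close>
  have "L = 1 + (\<integral>\<^sup>+t. g t * L \<partial>count_space UNIV)"
    unfolding L_def by (subst nn_integral_count_space_list) (simp add: nn_integral_cmult)
  also have "\<dots> = 1 + (\<integral>\<^sup>+t. g t \<partial>count_space UNIV) * L"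
    by (simp add: nn_integral_multc)
  also have "(\<integral>\<^sup>+t. g t \<partial>count_space UNIV) = (\<integral>\<^sup>+t. (
        tree_weight t * indicator {t. root_label t = k - 1 \<and> t \<in> {t. P t}} t +
        tree_weight t * indicator {t. root_label t = k \<and> t \<in> {t. P t}} t +
        tree_weight t * indicator {t. root_label t = k + 1 \<and> t \<in> {t. P t}} t) / 6 \<partial>count_space UNIV)"
    by (rule nn_integral_cong) (auto simp: g_def indicator_def)
  also have "\<dots> = (emeasure (\<rho> (k - 1)) {t. P t} + emeasure (\<rho> k) {t. P t}
                + emeasure (\<rho> (k + 1)) {t. P t}) / 6"
    unfolding emeasure_tree_law by (simp add: nn_integral_divide nn_integral_add)
  finally have "L = 1 + (emeasure (\<rho> (k - 1)) {t. P t} + emeasure (\<rho> k) {t. P t}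
                + emeasure (\<rho> (k + 1)) {t. P t}) / 6 * L" .
  moreover have "1/2 * L = 1/2 + c * (1/2 * L)" if "L = 1 + c * L" for c
  proof -
    have "1/2 * L = 1/2 * (1 + c * L)" by (rule arg_cong[OF that])
    then show ?thesis by (simp only: distrib_left mult.right_neutral mult.left_commute)
  qed
  ultimately show ?thesis unfolding s by blast
qed

text \<open>Half of the function \<open>R u(x) u(x + 3) / (u(x + 1) u(x + 2))\<close> known from
  distances in quadrangulations, in the critical case \<open>R = 2\<close>,
  \<open>u(x) = x\<close>.\<close>

definition min_label_bound :: "nat \<Rightarrow> real" where
  "min_label_bound x = real x * (real x + 3) / ((real x + 1) * (real x + 2))"

lemma min_label_bound_step:
  "min_label_bound (Suc x) * (1 - (min_label_bound x + min_label_bound (Suc x)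
     + min_label_bound (Suc (Suc x))) / 6) = 1 / 2"
proof -
  \<comment> \<open>With partial fractions the sum of three consecutive values telescopes.\<close>
  have eq: "min_label_bound n = 1 - 2 * (1 / (real n + 1)) + 2 * (1 / (real n + 2))" for n
    by (simp add: min_label_bound_def divide_simps) (simp add: algebra_simps)
  have "min_label_bound (Suc x) = 1 - 2 * (1 / (real x + 2)) + 2 * (1 / (real x + 3))"
    "min_label_bound (Suc (Suc x)) = 1 - 2 * (1 / (real x + 3)) + 2 * (1 / (real x + 4))"
    unfolding eq by (simp_all add: add_ac)
  then have "1 - (min_label_bound x + min_label_bound (Suc x) + min_label_bound (Suc (Suc x))) / 6
      = 1 / 2 + (1 / (real x + 1) - 1 / (real x + 4)) / 3"
    using eq[of x] by argo
  also have "\<dots> = (real x + 2) * (real x + 3) / (2 * ((real x + 1) * (real x + 4)))"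
    by (simp add: divide_simps) (simp add: algebra_simps)
  finally have sum: "1 - (min_label_bound x + min_label_bound (Suc x) + min_label_bound (Suc (Suc x))) / 6
      = (real x + 2) * (real x + 3) / (2 * ((real x + 1) * (real x + 4)))" .
  have "min_label_bound (Suc x) = (real x + 1) * (real x + 4) / ((real x + 2) * (real x + 3))"
    by (simp add: min_label_bound_def add_ac)
  then show ?thesis
    unfolding sum by simp
qed

lemma min_label_bound_bounds: "0 \<le> min_label_bound x" "min_label_bound x < 1"
proof -
  have "real x * (real x + 3) < (real x + 1) * (real x + 2)" by (simp add: algebra_simps)
  then show "min_label_bound x < 1"
    unfolding min_label_bound_def by (subst divide_less_eq_1_pos) auto
qed (simp add: min_label_bound_def)

text \<open>The total mass is carried as an assumption until \<open>emeasure_tree_law_0\<close>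
  derives it from the conditional law of the trees.\<close>

context
  assumes mass: "emeasure (\<rho> 0) UNIV = 1"
begin

lemma emeasure_tree_law_UNIV: "emeasure (\<rho> k) UNIV = 1"
  using emeasure_tree_law_shift[of 0 k UNIV] mass by simp

lemma space_tree_law [simp]: "space (\<rho> k) = UNIV" "sets (\<rho> k) = UNIV"
  by (auto simp: tree_law_def)

lemma prob_space_tree_law: "prob_space (\<rho> k)"
  by (rule prob_spaceI) (simp add: emeasure_tree_law_UNIV)

text \<open>Larger survival probabilities for the children give a larger one for the tree, and
  \<open>min_label_bound\<close> is a fixed point of this recursion, so the bound passes from
  \<open>h\<close> to \<open>Suc h\<close>. At height 0 the probability is 1 unless
  \<open>x = 0\<close>, where the bound is 0.\<close>

lemma positive_upto_bound:
  "min_label_bound x \<le> measure (\<rho> (int x)) {t. positive_upto h t}"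
proof (induction h arbitrary: x)
  case 0
  interpret prob_space "\<rho> (int x)" by (rule prob_space_tree_law)
  show ?case
  proof (cases "x = 0")
    case True then show ?thesis by (simp add: min_label_bound_def)
  next
    case False
    have "prob UNIV \<le> prob {t. positive_upto 0 t}"
    proof (rule finite_measure_mono_AE)
      show "AE t in \<rho> (int x). t \<in> UNIV \<longrightarrow> t \<in> {t. positive_upto 0 t}"
        using False unfolding tree_law_def by (subst AE_density) (auto simp: positive_upto_0 AE_count_space)
    qed simp
    then show ?thesis
      using min_label_bound_bounds(2)[of x] prob_space by simp
  qed
next
  case (Suc h)
  show ?case
  proof (cases x)
    case 0
    then show ?thesis by (simp add: min_label_bound_def)
  next
    case x: (Suc y)
    let ?m = "\<lambda>k. measure (\<rho> k) {t. positive_upto h t}"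
    let ?s = "measure (\<rho> (int x)) {t. positive_upto (Suc h) t}"
    interpret R: prob_space "\<rho> k" for k by (rule prob_space_tree_law)
    note fin = R.emeasure_eq_measure
    have half: "(1/2 :: ennreal) = ennreal (1/2)"
      by (metis ennreal_1 ennreal_divide_numeral zero_le_one)
    have "emeasure (\<rho> (int x)) {t. positive_upto (Suc h) t} =
        emeasure (\<rho> (int x)) {t. \<forall>u\<in>set (children t). positive_upto h u}"
      unfolding emeasure_tree_law
    proof (rule nn_integral_cong)
      fix t show "tree_weight t * indicator {t. root_label t = int x \<and> t \<in> {t. positive_upto (Suc h) t}} t
        = tree_weight t * indicator {t. root_label t = int x \<and> t \<in> {t. \<forall>u\<in>set (children t). positive_upto h u}} t"
        using x by (cases t) (auto simp: indicator_def)
    qed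
    then have "ennreal ?s = 1/2 + (ennreal (?m (int x - 1)) + ennreal (?m (int x)) + ennreal (?m (int x + 1))) / 6 * ennreal ?s"
      using tree_law_step[of "int x" "positive_upto h"] unfolding fin by metis
    also have "\<dots> = ennreal (1/2 + (?m (int x - 1) + ?m (int x) + ?m (int x + 1)) / 6 * ?s)"
      unfolding half by (simp add: ennreal_divide_numeral del: ennreal_half ennreal_plus flip: ennreal_plus ennreal_mult)
    finally have "?s = 1/2 + (?m (int x - 1) + ?m (int x) + ?m (int x + 1)) / 6 * ?s"
      by (rule ennreal_inj[THEN iffD1, rotated 2]) simp_all
    moreover have "1/2 = z * (1 - c)" if "z = 1/2 + c * z" for z c :: real
    proof -
      have "z - c * z = 1/2" using that by linarith
      then show ?thesis by (simp add: algebra_simps)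
    qed
    ultimately have "1/2 = ?s * (1 - (?m (int x - 1) + ?m (int x) + ?m (int x + 1)) / 6)"
      by blast
    also have "\<dots> \<le> ?s * (1 - (min_label_bound y + min_label_bound (Suc y) + min_label_bound (Suc (Suc y))) / 6)"
      using Suc.IH[of y] Suc.IH[of x] Suc.IH[of "Suc x"] x
      by (intro mult_left_mono diff_left_mono divide_right_mono add_mono) (auto simp: add.commute)
    finally have le: "min_label_bound x * (1 - (min_label_bound y + min_label_bound (Suc y) + min_label_bound (Suc (Suc y))) / 6)
       \<le> ?s * (1 - (min_label_bound y + min_label_bound (Suc y) + min_label_bound (Suc (Suc y))) / 6)"
      using min_label_bound_step[of y] x by simp
    have "0 < 1 - (min_label_bound y + min_label_bound (Suc y) + min_label_bound (Suc (Suc y))) / 6"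
      using min_label_bound_bounds(2)[of y] min_label_bound_bounds(2)[of "Suc y"]
        min_label_bound_bounds(2)[of "Suc (Suc y)"] by simp
    then show ?thesis using le by (simp add: mult_le_cancel_right)
  qed
qed

lemma positive_labels_bound:
  "min_label_bound x \<le> measure (\<rho> 0) {t. \<forall>l\<in>tree_labels t. - int x < l}"
proof -
  interpret prob_space "\<rho> (int x)" by (rule prob_space_tree_law)
  have "(\<lambda>h. prob {t. positive_upto h t}) \<longlonglongrightarrow> prob (\<Inter>h. {t. positive_upto h t})"
    by (rule finite_Lim_measure_decseq) (auto simp: decseq_Suc_iff positive_upto_Suc)
  then have "min_label_bound x \<le> prob (\<Inter>h. {t. positive_upto h t})"
    by (rule LIMSEQ_le_const) (use positive_upto_bound in blast)
  also have "\<dots> \<le> prob {t. \<forall>l\<in>tree_labels t. 0 < l}"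
    by (rule finite_measure_mono) (auto intro: tree_labels_positive)
  also have "\<dots> = measure (\<rho> 0) (shift_tree (int x) -` {t. \<forall>l\<in>tree_labels t. 0 < l})"
    using emeasure_tree_law_shift[of 0 "int x"] by (simp add: measure_def)
  also have "shift_tree (int x) -` {t. \<forall>l\<in>tree_labels t. 0 < l} = {t. \<forall>l\<in>tree_labels t. - int x < l}"
    by (auto simp: tree_labels_shift_tree)
  finally show ?thesis .
qed

end

section \<open>A renewal criterion\<close>

instance ltree :: countable
  by countable_datatype

lemma prob_replicate_pmf_add:
  fixes p :: "'a :: countable pmf"
  shows "measure (replicate_pmf (m + n) p) {zs. A (take m zs) \<and> B (drop m zs)}
    = measure (replicate_pmf m p) {xs. A xs} * measure (replicate_pmf n p) {ys. B ys}"
proof -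
  let ?P = "pair_pmf (replicate_pmf m p) (replicate_pmf n p)"
  have rep: "replicate_pmf (m + n) p = map_pmf (\<lambda>(xs, ys). xs @ ys) ?P"
    by (simp add: replicate_pmf_distrib pair_pmf_def map_bind_pmf bind_map_pmf bind_assoc_pmf
        bind_return_pmf)
  have "measure (replicate_pmf (m + n) p) {zs. A (take m zs) \<and> B (drop m zs)}
      = measure ?P {(xs, ys). A (take m (xs @ ys)) \<and> B (drop m (xs @ ys))}"
    unfolding rep measure_map_pmf by (simp add: vimage_def case_prod_unfold)
  also have "\<dots> = measure ?P ({xs. A xs} \<times> {ys. B ys})"
    by (rule measure_pmf.finite_measure_eq_AE) (auto simp: AE_measure_pmf_iff set_replicate_pmf)
  also have "\<dots> = measure (replicate_pmf m p) {xs. A xs} * measure (replicate_pmf n p) {ys. B ys}"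
    by (rule measure_pmf_prob_product) auto
  finally show ?thesis .
qed

text \<open>Independence is encoded by the joint law of the initial blocks, which is what can be
  computed for the bridge; the law of later blocks follows in \<open>prob_blocks\<close>.\<close>

locale iid_sequence = prob_space M for M :: "'w measure" +
  fixes X :: "'w \<Rightarrow> nat \<Rightarrow> 'a :: countable" and p :: "'a pmf"
  assumes X_measurable: "\<And>n. (\<lambda>\<omega>. X \<omega> n) \<in> M \<rightarrow>\<^sub>M count_space UNIV"
    and X_law: "\<And>n. distr M (count_space UNIV) (\<lambda>\<omega>. map (X \<omega>) [0..<n]) = measure_pmf (replicate_pmf n p)"
begin

lemma measurable_block [measurable]: "(\<lambda>\<omega>. map (X \<omega>) ns) \<in> M \<rightarrow>\<^sub>M count_space UNIV"
proof (induction ns)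
  case (Cons n ns)
  have "(\<lambda>\<omega>. x # map (X \<omega>) ns) \<in> M \<rightarrow>\<^sub>M count_space UNIV" for x
    using Cons by (rule measurable_compose) simp
  from measurable_compose_countable[OF this X_measurable[of n]] show ?case by simp
qed simp

lemma prob_blocks:
  "prob {\<omega> \<in> space M. A (map (X \<omega>) [0..<i]) \<and> B (map (X \<omega>) [i..<i + n])}
    = measure (replicate_pmf i p) {xs. A xs} * measure (replicate_pmf n p) {ys. B ys}"
proof -
  have eq: "take i (map (X \<omega>) [0..<i + n]) = map (X \<omega>) [0..<i]"
    "drop i (map (X \<omega>) [0..<i + n]) = map (X \<omega>) [i..<i + n]" for \<omega>
    by (auto simp: take_map drop_map)
  have "prob {\<omega> \<in> space M. A (map (X \<omega>) [0..<i]) \<and> B (map (X \<omega>) [i..<i + n])}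
      = measure (distr M (count_space UNIV) (\<lambda>\<omega>. map (X \<omega>) [0..<i + n]))
         {zs. A (take i zs) \<and> B (drop i zs)}"
    by (subst measure_distr) (auto simp: eq vimage_def Int_def conj_commute intro!: arg_cong[of _ _ prob])
  then show ?thesis
    by (simp add: X_law prob_replicate_pmf_add)
qed

text \<open>At most one of the first good blocks is followed by no further good block. Hence, if the
  expected number of good blocks is infinite, then a good block is almost surely followed by
  another one.\<close>

theorem infinitely_many_good_blocks:
  fixes good :: "'a list \<Rightarrow> bool"
  assumes cut: "\<And>xs ys. good (xs @ ys) \<Longrightarrow> good xs \<Longrightarrow> ys \<noteq> [] \<Longrightarrow> good ys"
    and cat: "\<And>xs ys. good xs \<Longrightarrow> good ys \<Longrightarrow> good (xs @ ys)"
    and div: "\<not> summable (\<lambda>n. measure (replicate_pmf n p) {xs. good xs})"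
  shows "AE \<omega> in M. infinite {n. good (map (X \<omega>) [0..<n])}"
proof -
  define P where "P n = measure (replicate_pmf n p) {xs. good xs}" for n
  define none where "none n xs \<longleftrightarrow> (\<forall>j\<in>{0<..n}. \<not> good (take j xs))" for n and xs :: "'a list"
  define q where "q n = measure (replicate_pmf n p) {xs. none n xs}" for n
  have none_block: "none n (map (X \<omega>) [i..<i + n]) \<longleftrightarrow> (\<forall>j\<in>{0<..n}. \<not> good (map (X \<omega>) [i..<i + j]))"
    for \<omega> i n
    by (auto simp: none_def take_map)
  have q_nonneg: "0 \<le> q n" for n by (simp add: q_def)
  \<comment> \<open>The events \<open>E i\<close> for \<open>i \<le> n\<close> are disjoint: if two
    of them held, \<open>cut\<close> would make the block between the two times good, and its length
    is at most \<open>n\<close>.\<close>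
  have sum_le: "(\<Sum>i\<le>n. P i) * q n \<le> 1" for n
  proof -
    define E where "E i = {\<omega> \<in> space M. good (map (X \<omega>) [0..<i]) \<and> none n (map (X \<omega>) [i..<i + n])}" for i
    have E: "E i \<in> sets M" "prob (E i) = P i * q n" for i
      unfolding E_def P_def q_def by (measurable, rule prob_blocks)
    have no: False if "\<omega> \<in> E i" "\<omega> \<in> E j" "i < j" "j \<le> n" for \<omega> i j
    proof -
      have "map (X \<omega>) [0..<j] = map (X \<omega>) [0..<i] @ map (X \<omega>) [i..<i + (j - i)]"
        using \<open>i < j\<close> upt_add_eq_append[of 0 i "j - i"] by simp
      then have "good (map (X \<omega>) [i..<i + (j - i)])"
        using that cut[of "map (X \<omega>) [0..<i]" "map (X \<omega>) [i..<i + (j - i)]"] by (auto simp: E_def)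
      moreover have "j - i \<in> {0<..n}" using that by auto
      ultimately show False using that(1) unfolding E_def none_block by blast
    qed
    have "disjoint_family_on E {..n}"
      using no by (fastforce simp: disjoint_family_on_def neq_iff)
    then have "(\<Sum>i\<le>n. prob (E i)) = prob (\<Union>i\<le>n. E i)"
      by (intro finite_measure_finite_Union[symmetric]) (use E in auto)
    then show ?thesis by (simp add: E sum_distrib_right)
  qed
  have next_good: "AE \<omega> in M. \<exists>j>0. good (map (X \<omega>) [i..<i + j])" for i
  proof -
    define N where "N = {\<omega> \<in> space M. \<forall>j>0. \<not> good (map (X \<omega>) [i..<i + j])}"
    have N: "N \<in> sets M" unfolding N_def by measurable
    have le_q: "prob N \<le> q n" for n
    proof -
      have "prob N \<le> prob {\<omega> \<in> space M. True \<and> none n (map (X \<omega>) [i..<i + n])}"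
        by (rule finite_measure_mono) (auto simp: N_def none_block)
      also have "\<dots> = q n"
        unfolding q_def using prob_blocks[of "\<lambda>_. True" i "none n" n] by simp
      finally show ?thesis .
    qed
    have "prob N = 0"
    proof (rule ccontr)
      assume "prob N \<noteq> 0"
      then have pos: "0 < prob N" by (simp add: zero_less_measure_iff)
      \<comment> \<open>Every \<open>q n\<close> is at least \<open>prob N\<close>, so a positive
        \<open>prob N\<close> would bound the partial sums of \<open>P\<close>.\<close>
      have "(\<Sum>i<n. P i) \<le> 1 / prob N" for n
      proof -
        have "(\<Sum>i<n. P i) * prob N \<le> (\<Sum>i\<le>n. P i) * q n"
          by (intro mult_mono sum_mono2 le_q sum_nonneg) (auto simp: P_def)
        then show ?thesis using sum_le[of n] pos by (simp add: field_simps)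
      qed
      then have "summable P"
        by (intro summableI_nonneg_bounded) (auto simp: P_def)
      then show False using div by (simp add: P_def[abs_def])
    qed
    moreover have "{\<omega> \<in> space M. \<not> (\<exists>j>0. good (map (X \<omega>) [i..<i + j]))} = N"
      unfolding N_def by blast
    ultimately show ?thesis
      using AE_iff_measurable[OF N] by (simp add: emeasure_eq_measure)
  qed
  have "AE \<omega> in M. \<forall>i. \<exists>j>0. good (map (X \<omega>) [i..<i + j])"
    using next_good by (simp add: AE_all_countable)
  then show ?thesis
  proof (rule AE_mp, intro AE_I2 impI)
    fix \<omega> assume ev: "\<forall>i. \<exists>j>0. good (map (X \<omega>) [i..<i + j])"
    have "\<exists>n>m. good (map (X \<omega>) [0..<n])" for m
    proof (induction m)
      case 0
      show ?case using ev[rule_format, of 0] by simp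
    next
      case (Suc m)
      then obtain n where n: "m < n" "good (map (X \<omega>) [0..<n])" by blast
      obtain j where j: "j > 0" "good (map (X \<omega>) [n..<n + j])" using ev by blast
      have "good (map (X \<omega>) [0..<n + j])"
        using cat[OF n(2) j(2)] upt_add_eq_append[of 0 n j] by simp
      then show ?case using n j by (intro exI[of _ "n + j"]) auto
    qed
    then show "infinite {n. good (map (X \<omega>) [0..<n])}"
      by (simp add: infinite_nat_iff_unbounded)
  qed
qed

end

section \<open>Good blocks are frequent\<close>

text \<open>Since \<open>d\<close> is at most \<open>f\<close>, which tends to 0, a positive value
  of \<open>d\<close> would entail a positive maximum, attained away from 0. There the inequality
  fails because the coefficients sum to less than 1.\<close>

lemma max_principle:
  fixes d f \<alpha> \<beta> :: "nat \<Rightarrow> real"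
  assumes d0: "d 0 \<le> 0" and sub: "\<And>x. d (Suc x) \<le> \<alpha> x * d (Suc (Suc x)) + \<beta> x * d x"
    and coeff: "\<And>x. 0 \<le> \<alpha> x" "\<And>x. 0 \<le> \<beta> x" "\<And>x. \<alpha> x + \<beta> x < 1"
    and le: "\<And>x. d x \<le> f x" and lim: "f \<longlonglongrightarrow> 0"
  shows "d x \<le> 0"
proof (rule ccontr)
  assume "\<not> d x \<le> 0"
  then have pos: "0 < d x" by simp
  have "eventually (\<lambda>y. f y < d x) sequentially"
    using order_tendstoD(2)[OF lim pos] .
  then obtain N where N: "\<And>y. y \<ge> N \<Longrightarrow> f y < d x" by (auto simp: eventually_sequentially)
  have small: "d y < d x" if "y \<ge> N" for y using N[OF that] le[of y] by linarith
  have "finite (d ` {..N})" "d ` {..N} \<noteq> {}" by auto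
  then obtain z where z: "z \<le> N" "d z = Max (d ` {..N})" using Max_in by (metis (no_types, lifting) atMost_iff imageE)
  have x: "x \<le> N" using small[of x] by (meson less_irrefl nle_le)
  have max: "d y \<le> d z" for y
  proof (cases "y \<le> N")
    case True then show ?thesis unfolding z(2) by (intro Max_ge) auto
  next
    case False
    then have "d y < d x" using small by simp
    also have "d x \<le> d z" unfolding z(2) using x by (intro Max_ge) auto
    finally show ?thesis by simp
  qed
  have dz: "0 < d z" using pos max[of x] by linarith
  then obtain w where w: "z = Suc w" using d0 by (cases z) auto
  have "d z \<le> \<alpha> w * d (Suc (Suc w)) + \<beta> w * d w" using sub[of w] w by simp
  also have "\<dots> \<le> \<alpha> w * d z + \<beta> w * d z"
    by (intro add_mono mult_left_mono max coeff)
  also have "\<dots> = (\<alpha> w + \<beta> w) * d z" by (simp add: algebra_simps)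
  also have "\<dots> < 1 * d z" using coeff(3) dz by (intro mult_strict_right_mono)
  finally show False by simp
qed

section \<open>Good lists and their expected number\<close>

definition depth_step :: "int \<Rightarrow> ltree option \<Rightarrow> int" where
  "depth_step \<sigma> x = (case x of None \<Rightarrow> - \<sigma> | Some t \<Rightarrow> \<sigma>)"

definition depth :: "int \<Rightarrow> ltree option list \<Rightarrow> int" where
  "depth \<sigma> xs = (\<Sum>x\<leftarrow>xs. depth_step \<sigma> x)"

lemma depth_simps [simp]: "depth \<sigma> [] = 0" "depth \<sigma> (x # xs) = depth_step \<sigma> x + depth \<sigma> xs"
  "depth \<sigma> (xs @ ys) = depth \<sigma> xs + depth \<sigma> ys"
  by (auto simp: depth_def)

text \<open>Here \<open>y\<close> is the height of the root above the reference level, and the tree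
  has been shifted to root label 0.\<close>

definition labels_above :: "ltree option \<Rightarrow> int \<Rightarrow> bool" where
  "labels_above x y \<longleftrightarrow> (case x of None \<Rightarrow> True | Some t \<Rightarrow> \<forall>l\<in>tree_labels t. - y < l)"

text \<open>An entry \<open>Some t\<close> stands for a down-step carrying the tree \<open>t\<close>, shifted to have root label
  \<open>0\<close>, and \<open>None\<close> for an up-step. For \<open>\<sigma> = 1\<close> the list is read from left to right, for \<open>\<sigma> = -1\<close>
  from right to left. The depth is the height of the first end above the last one, and a list is
  good if its last end lies below everything that precedes it. The tree of a down-step has its root
  at the upper end of the step, hence the maximum.\<close>

fun good :: "int \<Rightarrow> ltree option list \<Rightarrow> bool" where
  "good \<sigma> [] \<longleftrightarrow> True"
| "good \<sigma> (x # xs) \<longleftrightarrow> 0 < depth \<sigma> (x # xs) \<and>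
     labels_above x (max (depth \<sigma> xs) (depth \<sigma> (x # xs))) \<and> good \<sigma> xs"

lemma good_depth_nonneg: "good \<sigma> xs \<Longrightarrow> 0 \<le> depth \<sigma> xs"
  by (cases xs) auto

lemma good_appendD: "good \<sigma> (xs @ ys) \<Longrightarrow> good \<sigma> ys"
  by (induction xs) auto

lemma labels_above_mono: "labels_above x y \<Longrightarrow> y \<le> z \<Longrightarrow> labels_above x z"
  by (force simp: labels_above_def split: option.splits)

text \<open>Appending \<open>ys\<close> lowers the last end by \<open>depth \<sigma> ys\<close>,
  which is nonnegative and thus only relaxes the conditions on \<open>xs\<close>.\<close>

lemma good_append: "good \<sigma> xs \<Longrightarrow> good \<sigma> ys \<Longrightarrow> good \<sigma> (xs @ ys)"
proof (induction xs)
  case (Cons x xs)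
  then show ?case
    using good_depth_nonneg[OF Cons.prems(2)] by (auto elim!: labels_above_mono)
qed simp

text \<open>Together the two conditions force the last entry to be a down-step; the position before it
  is then a record.\<close>

definition good_down :: "ltree option list \<Rightarrow> bool" where
  "good_down xs \<longleftrightarrow> xs \<noteq> [] \<and> good 1 xs \<and> good 1 (butlast xs)"

context
  fixes \<mu> :: "ltree option pmf"
  assumes pmf_None: "pmf \<mu> None = 1 / 2"
    and tail: "\<And>x. measure \<mu> (Some ` {t. \<forall>l\<in>tree_labels t. - int x < l}) \<ge> min_label_bound x / 2"
begin

text \<open>Adding entries in front makes the depth a walk from 0, killed when it returns to 0 or
  when a tree reaches too low. Summed over \<open>n\<close>, this is the Green function of that
  walk.\<close>

definition green_step :: "int \<Rightarrow> nat \<Rightarrow> nat \<Rightarrow> real" where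
  "green_step \<sigma> n x = measure (replicate_pmf n \<mu>) {xs. good \<sigma> xs \<and> depth \<sigma> xs = int x}"

text \<open>Split off the first entry: a down-step leaves depth \<open>x + 1 - \<sigma>\<close> and
  its tree must stay above the last end, an up-step leaves depth \<open>x + 1 + \<sigma>\<close>.
  The target is \<open>Suc x\<close> because nonempty good lists have positive depth.\<close>

lemma green_step_Suc:
  assumes \<sigma>: "\<bar>\<sigma>\<bar> = 1"
  shows "min_label_bound (nat (max (int x + 1) (int x + 1 - \<sigma>))) / 2
      * green_step \<sigma> n (nat (int x + 1 - \<sigma>)) + 1 / 2 * green_step \<sigma> n (nat (int x + 1 + \<sigma>))
    \<le> green_step \<sigma> (Suc n) (Suc x)"
proof -
  let ?y = "nat (max (int x + 1) (int x + 1 - \<sigma>))"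
  let ?R = "replicate_pmf n \<mu>"
  let ?A = "\<lambda>x. {xs. good \<sigma> xs \<and> depth \<sigma> xs = int x}"
  let ?S = "Some ` {t. \<forall>l\<in>tree_labels t. - int ?y < l} \<times> ?A (nat (int x + 1 - \<sigma>))"
  let ?N = "{None} \<times> ?A (nat (int x + 1 + \<sigma>))"
  have nn: "0 \<le> int x + 1 - \<sigma>" "0 \<le> int x + 1 + \<sigma>" using \<sigma> by auto
  have rep: "replicate_pmf (Suc n) \<mu> = map_pmf (\<lambda>(x, xs). x # xs) (pair_pmf \<mu> ?R)"
    by (simp add: pair_pmf_def map_bind_pmf)
  have "measure (pair_pmf \<mu> ?R) ?S + measure (pair_pmf \<mu> ?R) ?N = measure (pair_pmf \<mu> ?R) (?S \<union> ?N)"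
    by (rule measure_pmf.finite_measure_Union[symmetric]) auto
  also have "\<dots> \<le> measure (pair_pmf \<mu> ?R) ((\<lambda>(x, xs). x # xs) -` ?A (Suc x))"
    using nn by (intro measure_pmf.finite_measure_mono)
      (auto simp: depth_step_def labels_above_def max_def split: if_splits)
  also have "\<dots> = green_step \<sigma> (Suc n) (Suc x)"
    unfolding green_step_def rep measure_map_pmf ..
  finally have le: "measure (pair_pmf \<mu> ?R) ?S + measure (pair_pmf \<mu> ?R) ?N \<le> green_step \<sigma> (Suc n) (Suc x)" .
  have "measure (pair_pmf \<mu> ?R) ?S
      = measure \<mu> (Some ` {t. \<forall>l\<in>tree_labels t. - int ?y < l}) * green_step \<sigma> n (nat (int x + 1 - \<sigma>))"
    unfolding green_step_def by (rule measure_pmf_prob_product) auto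
  moreover have "measure (pair_pmf \<mu> ?R) ?N = 1 / 2 * green_step \<sigma> n (nat (int x + 1 + \<sigma>))"
    unfolding green_step_def using pmf_None
    by (subst measure_pmf_prob_product) (auto simp: measure_pmf_single)
  moreover have "min_label_bound ?y / 2 * green_step \<sigma> n (nat (int x + 1 - \<sigma>))
      \<le> measure \<mu> (Some ` {t. \<forall>l\<in>tree_labels t. - int ?y < l}) * green_step \<sigma> n (nat (int x + 1 - \<sigma>))"
    by (intro mult_right_mono tail) (simp add: green_step_def)
  ultimately show ?thesis using le by linarith
qed

text \<open>The expected number of good prefixes of depth \<open>x\<close> is at least \<open>1 / (x + 1)\<close> for
  \<open>\<sigma> = 1\<close> and at least \<open>3 / (x + 3)\<close> for \<open>\<sigma> = -1\<close>, as these functions solve the corresponding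
  recursion with the exact law of the smallest label.\<close>

lemma not_summable_good:
  assumes \<sigma>: "\<sigma> = 1 \<or> \<sigma> = -1"
  shows "\<not> summable (\<lambda>n. measure (replicate_pmf n \<mu>) {xs. good \<sigma> xs})"
proof
  assume sum: "summable (\<lambda>n. measure (replicate_pmf n \<mu>) {xs. good \<sigma> xs})"
  have le1: "green_step \<sigma> n x \<le> measure (replicate_pmf n \<mu>) {xs. good \<sigma> xs}" for n x
    unfolding green_step_def by (intro measure_pmf.finite_measure_mono) auto
  have nonneg: "0 \<le> green_step \<sigma> n x" for n x by (simp add: green_step_def)
  have sg: "summable (\<lambda>n. green_step \<sigma> n x)" for x
    by (rule summable_comparison_test'[OF sum, of 0]) (use le1 nonneg in auto)
  have sg_Suc: "summable (\<lambda>n. green_step \<sigma> (Suc n) x)" for x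
    using sg[of x] by (subst summable_Suc_iff)
  \<comment> \<open>The assumed summability makes this sum finite, so the comparison can be carried
    out in the reals.\<close>
  define G where "G x = (\<Sum>n. green_step \<sigma> n x)" for x
  have Gnn: "0 \<le> G x" for x unfolding G_def by (intro suminf_nonneg sg nonneg)
  have G0: "1 \<le> G 0"
  proof -
    have "green_step \<sigma> 0 0 = 1" by (simp add: green_step_def)
    then show ?thesis unfolding G_def
      using sum_le_suminf[OF sg, of "{0}" 0] nonneg by simp
  qed
  have Gstep: "min_label_bound (nat (max (int x + 1) (int x + 1 - \<sigma>))) / 2 * G (nat (int x + 1 - \<sigma>))
      + 1 / 2 * G (nat (int x + 1 + \<sigma>)) \<le> G (Suc x)" for x
  proof -
    have "min_label_bound (nat (max (int x + 1) (int x + 1 - \<sigma>))) / 2 * G (nat (int x + 1 - \<sigma>))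
      + 1 / 2 * G (nat (int x + 1 + \<sigma>)) =
      (\<Sum>n. min_label_bound (nat (max (int x + 1) (int x + 1 - \<sigma>))) / 2
      * green_step \<sigma> n (nat (int x + 1 - \<sigma>)) + 1 / 2 * green_step \<sigma> n (nat (int x + 1 + \<sigma>)))"
      unfolding G_def
      by (rule sums_unique[OF sums_add[OF sums_mult[OF summable_sums[OF sg]] sums_mult[OF summable_sums[OF sg]]]])
    also have "\<dots> \<le> (\<Sum>n. green_step \<sigma> (Suc n) (Suc x))"
      using \<sigma> by (intro suminf_le green_step_Suc summable_add summable_mult sg sg_Suc) auto
    also have "\<dots> \<le> G (Suc x)"
      unfolding G_def using suminf_split_head[OF sg, of "Suc x"] nonneg[of 0 "Suc x"] by simp
    finally show ?thesis .
  qed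
  have low: "1 / (real x + 1) \<le> G x" for x
    using \<sigma>
  proof
    assume s: "\<sigma> = 1"
    let ?f = "\<lambda>x. 1 / (real x + 1)"
    have "?f x - G x \<le> 0"
    proof (rule max_principle[where f = ?f and \<alpha> = "\<lambda>_. 1/2" and \<beta> = "\<lambda>x. min_label_bound (Suc x) / 2"])
      fix x
      have "?f (Suc x) = 1/2 * ?f (Suc (Suc x)) + min_label_bound (Suc x) / 2 * ?f x"
        by (simp add: min_label_bound_def divide_simps) (simp add: algebra_simps)
      moreover have "1/2 * G (Suc (Suc x)) + min_label_bound (Suc x) / 2 * G x \<le> G (Suc x)"
        using Gstep[of x] s by (simp add: nat_add_distrib max_def add.commute)
      ultimately show "?f (Suc x) - G (Suc x)
          \<le> 1/2 * (?f (Suc (Suc x)) - G (Suc (Suc x))) + min_label_bound (Suc x) / 2 * (?f x - G x)"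
        unfolding right_diff_distrib by linarith
    next
      show "?f \<longlonglongrightarrow> 0" by real_asymp
      show "1/2 + min_label_bound (Suc x) / 2 < 1" for x
        using min_label_bound_bounds(2)[of "Suc x"] by simp
    qed (use G0 Gnn min_label_bound_bounds(1) in auto)
    then show ?thesis by simp
  next
    assume s: "\<sigma> = -1"
    let ?f = "\<lambda>x. 3 / (real x + 3)"
    have "?f x - G x \<le> 0"
    proof (rule max_principle[where f = ?f and \<alpha> = "\<lambda>x. min_label_bound (Suc (Suc x)) / 2" and \<beta> = "\<lambda>_. 1/2"])
      fix x
      have "?f (Suc x) = min_label_bound (Suc (Suc x)) / 2 * ?f (Suc (Suc x)) + 1/2 * ?f x"
        by (simp add: min_label_bound_def divide_simps) (simp add: algebra_simps)
      moreover have "min_label_bound (Suc (Suc x)) / 2 * G (Suc (Suc x)) + 1/2 * G x \<le> G (Suc x)"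
        using Gstep[of x] s by (simp add: nat_add_distrib max_def add.commute)
      ultimately show "?f (Suc x) - G (Suc x)
          \<le> min_label_bound (Suc (Suc x)) / 2 * (?f (Suc (Suc x)) - G (Suc (Suc x))) + 1/2 * (?f x - G x)"
        unfolding right_diff_distrib by linarith
    next
      show "?f \<longlonglongrightarrow> 0" by real_asymp
      show "min_label_bound (Suc (Suc x)) / 2 + 1/2 < 1" for x
        using min_label_bound_bounds(2)[of "Suc (Suc x)"] by simp
    qed (use G0 Gnn min_label_bound_bounds(1) in auto)
    moreover have "1 / (real x + 1) \<le> ?f x" by (simp add: field_simps)
    ultimately show ?thesis by simp
  qed
  \<comment> \<open>Different depths are disjoint events, so the sum of \<open>G\<close> over depths
    is dominated by the assumed convergent series.\<close>
  have "(\<Sum>x<k. inverse (real (Suc x))) \<le> (\<Sum>n. measure (replicate_pmf n \<mu>) {xs. good \<sigma> xs})" for k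
  proof -
    have "(\<Sum>x<k. inverse (real (Suc x))) \<le> (\<Sum>x<k. G x)"
      using low by (intro sum_mono) (auto simp: inverse_eq_divide add.commute)
    also have "\<dots> = (\<Sum>n. \<Sum>x<k. green_step \<sigma> n x)"
      unfolding G_def by (rule suminf_sum[symmetric]) (rule sg)
    also have "\<dots> \<le> (\<Sum>n. measure (replicate_pmf n \<mu>) {xs. good \<sigma> xs})"
    proof (intro suminf_le summable_sum sg sum)
      fix n
      have "(\<Sum>x<k. green_step \<sigma> n x)
          = measure (replicate_pmf n \<mu>) (\<Union>x<k. {xs. good \<sigma> xs \<and> depth \<sigma> xs = int x})"
        unfolding green_step_def
        by (rule measure_pmf.finite_measure_finite_Union[symmetric]) (auto simp: disjoint_family_on_def)
      also have "\<dots> \<le> measure (replicate_pmf n \<mu>) {xs. good \<sigma> xs}"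
        by (intro measure_pmf.finite_measure_mono) auto
      finally show "(\<Sum>x<k. green_step \<sigma> n x) \<le> measure (replicate_pmf n \<mu>) {xs. good \<sigma> xs}" .
    qed
    finally show ?thesis .
  qed
  then have "summable (\<lambda>x. inverse (real (Suc x)))"
    by (intro summableI_nonneg_bounded) auto
  then show False
    using not_summable_harmonic[where 'a = real] by (subst (asm) summable_Suc_iff) simp
qed

text \<open>A good list followed by a good list of length 1 satisfies \<open>good_down\<close>, and
  a list of length 1 is good with positive probability.\<close>

lemma not_summable_good_down: "\<not> summable (\<lambda>n. measure (replicate_pmf n \<mu>) {xs. good_down xs})"
proof
  let ?P = "\<lambda>n. measure (replicate_pmf n \<mu>) {xs. good 1 xs}"
  assume "summable (\<lambda>n. measure (replicate_pmf n \<mu>) {xs. good_down xs})"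
  then have sum: "summable (\<lambda>n. measure (replicate_pmf (Suc n) \<mu>) {xs. good_down xs})"
    by (subst summable_Suc_iff)
  have le: "?P n * ?P 1 \<le> measure (replicate_pmf (Suc n) \<mu>) {xs. good_down xs}" for n
  proof -
    have "?P n * ?P 1 = measure (replicate_pmf (n + 1) \<mu>) {zs. good 1 (take n zs) \<and> good 1 (drop n zs)}"
      by (rule prob_replicate_pmf_add[symmetric])
    also have "\<dots> \<le> measure (replicate_pmf (n + 1) \<mu>) {xs. good_down xs}"
    proof (intro measure_pmf.finite_measure_mono_AE AE_pmfI impI)
      fix zs assume zs: "zs \<in> set_pmf (replicate_pmf (n + 1) \<mu>)"
        "zs \<in> {zs. good 1 (take n zs) \<and> good 1 (drop n zs)}"
      then have "length zs = Suc n" by (simp add: set_replicate_pmf del: replicate_pmf.simps)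
      moreover have "good 1 (take n zs @ drop n zs)" using zs by (intro good_append) auto
      ultimately show "zs \<in> {xs. good_down xs}"
        using zs by (auto simp: good_down_def butlast_conv_take)
    qed simp
    finally show ?thesis by simp
  qed
  have "0 < min_label_bound 1 / 2" by (simp add: min_label_bound_def)
  also have "\<dots> \<le> measure \<mu> (Some ` {t. \<forall>l\<in>tree_labels t. - int 1 < l})" by (rule tail)
  also have "\<dots> \<le> ?P 1"
    unfolding replicate_pmf_1 measure_map_pmf
    by (intro measure_pmf.finite_measure_mono) (auto simp: depth_step_def labels_above_def)
  finally have pos: "0 < ?P 1" .
  have "summable (\<lambda>n. ?P n * ?P 1)"
    by (rule summable_comparison_test'[OF sum, of 0]) (use le in auto)
  from summable_mult2[OF this, of "1 / ?P 1"] have "summable ?P" using pos by simp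
  then show False using not_summable_good[of 1] by simp
qed

end

section \<open>The steps of the treed bridge\<close>

definition block_step :: "ltree option \<Rightarrow> int" where
  "block_step x = (if x = None then 1 else -1)"

text \<open>With \<open>b i\<close> subtracted from the labels, the law of an entry no longer
  depends on the height of the walk, so that the entries become i.i.d.\<close>

definition bridge_step :: "(int \<Rightarrow> int) \<Rightarrow> (int \<Rightarrow> ltree) \<Rightarrow> int \<Rightarrow> ltree option" where
  "bridge_step b T i = (if i \<in> DS b then Some (shift_tree (- b i) (T i)) else None)"

lemma shift_tree_eq_iff: "shift_tree (- k) u = t \<longleftrightarrow> u = shift_tree k t"
  by (metis add.left_inverse add.right_inverse shift_tree_0 shift_tree_shift_tree)

lemma measure_tree_law_singleton_shift: "measure (\<rho> k) {shift_tree k t} = measure (\<rho> 0) {t}"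
proof -
  have "shift_tree k -` {shift_tree k t} = {t}"
    using bij_shift_tree[of k] by (auto simp: bij_def inj_def)
  then show ?thesis
    using emeasure_tree_law_shift[of 0 k "{shift_tree k t}"] by (simp add: measure_def)
qed

lemma pmf_replicate_pmf:
  "pmf (replicate_pmf (length xs) p) xs = (\<Prod>k<length xs. pmf p (xs ! k))"
proof (induction xs)
  case (Cons x xs)
  have "replicate_pmf (length (x # xs)) p
      = map_pmf (\<lambda>(x, xs). x # xs) (pair_pmf p (replicate_pmf (length xs) p))"
    by (simp add: pair_pmf_def map_bind_pmf)
  then have "pmf (replicate_pmf (length (x # xs)) p) ((\<lambda>(x, xs). x # xs) (x, xs))
      = pmf (pair_pmf p (replicate_pmf (length xs) p)) (x, xs)"
    by (simp only:) (rule pmf_map_inj', auto simp: inj_def)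
  then show ?case
    using Cons by (simp add: pmf_pair prod.lessThan_Suc_shift del: replicate_pmf.simps prod.lessThan_Suc)
qed simp

lemma (in prob_space) simple_random_walk_paths:
  assumes walk: "simple_random_walk X" and s: "\<And>k. k < n \<Longrightarrow> s k \<in> {-1, 1}"
  shows "prob {\<omega> \<in> space M. X \<omega> 0 = 0 \<and> (\<forall>k<n. X \<omega> (Suc k) - X \<omega> k = s k)} = (1/2) ^ n"
proof -
  have meas [measurable]: "(\<lambda>\<omega>. X \<omega> k) \<in> M \<rightarrow>\<^sub>M count_space UNIV" for k
    using walk unfolding simple_random_walk_def
    by (auto intro: measurable_compose[OF _ measurable_component_singleton, of X])
  have X0: "AE \<omega> in M. X \<omega> 0 = 0" using walk by (simp add: simple_random_walk_def)
  let ?D = "\<lambda>k \<omega>. X \<omega> (Suc k) - X \<omega> k"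
  have D [measurable]: "?D k \<in> M \<rightarrow>\<^sub>M count_space UNIV" for k by measurable
  have one: "prob (?D k -` {s k} \<inter> space M) = 1/2" if "k < n" for k
  proof -
    have "prob (?D k -` {s k} \<inter> space M) = measure (distr M (count_space UNIV) (?D k)) {s k}"
      by (rule measure_distr[symmetric]) auto
    also have "\<dots> = pmf (pmf_of_set {-1, 1}) (s k)"
      using walk by (simp add: simple_random_walk_def measure_pmf_single)
    also have "\<dots> = 1/2" using s[OF that] by (subst pmf_of_set) auto
    finally show ?thesis .
  qed
  have "prob {\<omega> \<in> space M. X \<omega> 0 = 0 \<and> (\<forall>k<n. ?D k \<omega> = s k)} = prob {\<omega> \<in> space M. \<forall>k<n. ?D k \<omega> = s k}"
    by (rule finite_measure_eq_AE) (use X0 in auto)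
  also have "\<dots> = (1/2) ^ n"
  proof (cases "n = 0")
    case False
    have "{\<omega> \<in> space M. \<forall>k<n. ?D k \<omega> = s k} = (\<Inter>k\<in>{..<n}. ?D k -` {s k} \<inter> space M)"
      using False by auto
    also have "prob \<dots> = (\<Prod>k<n. prob (?D k -` {s k} \<inter> space M))"
      using walk False unfolding simple_random_walk_def by (intro indep_varsD[where I = UNIV]) auto
    finally show ?thesis using one by simp
  qed (simp add: prob_space)
  finally show ?thesis .
qed

lemma (in prob_space) simple_random_walk_AE:
  assumes walk: "simple_random_walk X"
  shows "AE \<omega> in M. X \<omega> 0 = 0 \<and> (\<forall>k. X \<omega> (Suc k) - X \<omega> k \<in> {-1, 1})"
proof -
  have "AE \<omega> in M. X \<omega> (Suc k) - X \<omega> k \<in> {-1, 1}" for k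
  proof -
    have meas: "(\<lambda>\<omega>. X \<omega> k) \<in> M \<rightarrow>\<^sub>M count_space UNIV" for k
      using walk unfolding simple_random_walk_def
      by (auto intro: measurable_compose[OF _ measurable_component_singleton, of X])
    have [measurable]: "(\<lambda>\<omega>. X \<omega> (Suc k) - X \<omega> k) \<in> M \<rightarrow>\<^sub>M count_space UNIV"
      using meas by measurable
    have "AE x in distr M (count_space UNIV) (\<lambda>\<omega>. X \<omega> (Suc k) - X \<omega> k). x \<in> {-1, 1}"
    proof -
      have eq: "distr M (count_space UNIV) (\<lambda>\<omega>. X \<omega> (Suc k) - X \<omega> k) = measure_pmf (pmf_of_set {-1, 1})"
        using walk by (simp add: simple_random_walk_def)
      show ?thesis unfolding eq by (simp add: AE_measure_pmf_iff)
    qed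
    then show ?thesis by (subst (asm) AE_distr_iff) auto
  qed
  then show ?thesis
    using walk by (simp add: simple_random_walk_def AE_all_countable)
qed

section \<open>From the conditional law of the trees to independent steps\<close>

context uniform_infinite_treed_bridge
begin

abbreviation bridge_algebra :: "'w measure" where
  "bridge_algebra \<equiv> vimage_algebra (space M) b (\<Pi>\<^sub>M i\<in>UNIV. count_space UNIV)"

lemma b_component: "(\<lambda>\<omega>. b \<omega> i) \<in> bridge_algebra \<rightarrow>\<^sub>M count_space UNIV"
proof -
  have "b \<in> bridge_algebra \<rightarrow>\<^sub>M (\<Pi>\<^sub>M i\<in>UNIV. count_space UNIV)"
    by (rule measurable_vimage_algebra1) (simp add: space_PiM)
  then show ?thesis by (rule measurable_compose) simp
qed

lemma subalgebra_bridge: "subalgebra M bridge_algebra"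
proof -
  have "sets bridge_algebra \<subseteq> sets M"
    unfolding sets_vimage_algebra using measurable_sets[OF b_measurable]
    by (intro sets.sigma_sets_subset) auto
  then show ?thesis by (simp add: subalgebra_def)
qed

lemma b_component_M [measurable]: "(\<lambda>\<omega>. b \<omega> i) \<in> M \<rightarrow>\<^sub>M count_space UNIV"
  by (rule measurable_compose[OF b_measurable]) simp

lemma T_component_M [measurable]: "(\<lambda>\<omega>. T \<omega> i) \<in> M \<rightarrow>\<^sub>M count_space UNIV"
  by (rule measurable_compose[OF T_measurable]) simp

text \<open>The conditional law integrated over \<open>A\<close>: the heights \<open>b i\<close> are
  fixed on \<open>A\<close>, so the product of tree probabilities is constant there.\<close>

lemma prob_trees:
  assumes A: "A \<in> sets bridge_algebra" and J: "finite J"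
    and on_A: "\<And>\<omega> i. \<omega> \<in> A \<Longrightarrow> i \<in> J \<Longrightarrow> i \<in> DS (b \<omega>) \<and> b \<omega> i = \<beta> i"
  shows "prob {\<omega> \<in> A. \<forall>i\<in>J. T \<omega> i \<in> B i} = prob A * (\<Prod>i\<in>J. measure (\<rho> (\<beta> i)) (B i))"
proof -
  interpret finite_measure_subalgebra M bridge_algebra
    by unfold_locales (rule subalgebra_bridge)
  let ?E = "{\<omega> \<in> space M. J \<subseteq> DS (b \<omega>) \<and> (\<forall>i\<in>J. T \<omega> i \<in> B i)}"
  have AM: "A \<in> sets M" using A subalgebra_bridge by (auto simp: subalgebra_def)
  have E: "?E \<in> sets M"
    unfolding DS_def subset_eq using J by measurable
  have "prob {\<omega> \<in> A. \<forall>i\<in>J. T \<omega> i \<in> B i} = prob (A \<inter> ?E)"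
    using on_A sets.sets_into_space[OF AM] by (intro arg_cong[of _ _ prob]) auto
  also have "\<dots> = (\<integral>\<omega>\<in>A. indicat_real ?E \<omega> \<partial>M)"
    using AM E by (simp add: set_lebesgue_integral_def indicator_inter_arith[symmetric])
  also have "\<dots> = (\<integral>\<omega>\<in>A. real_cond_exp M bridge_algebra (indicat_real ?E) \<omega> \<partial>M)"
    by (rule real_cond_exp_intA[OF _ A], rule integrable_real_indicator[OF E])
      (simp add: less_top[symmetric])
  also have "\<dots> = (\<integral>\<omega>. indicat_real A \<omega> * (\<Prod>i\<in>J. measure (\<rho> (\<beta> i)) (B i)) \<partial>M)"
    unfolding set_lebesgue_integral_def
  proof (rule integral_cong_AE)
    show "AE \<omega> in M. indicat_real A \<omega> *\<^sub>R real_cond_exp M bridge_algebra (indicat_real ?E) \<omega>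
        = indicat_real A \<omega> * (\<Prod>i\<in>J. measure (\<rho> (\<beta> i)) (B i))"
      using T_conditional_law[OF J, of B]
    proof eventually_elim
      case (elim \<omega>)
      then show ?case using on_A[of \<omega>] by (auto simp: indicator_def intro!: prod.cong)
    qed
  qed (use AM in simp_all)
  also have "\<dots> = prob A * (\<Prod>i\<in>J. measure (\<rho> (\<beta> i)) (B i))"
    using AM by simp
  finally show ?thesis .
qed

text \<open>On an event of probability \<open>1/2\<close> where 0 is a down-step, the conditional
  law with the trivial condition \<open>T \<omega> 0 \<in> UNIV\<close> gives
  \<open>1/2 = 1/2 * measure (\<rho> 0) UNIV\<close>. As \<open>measure\<close> is 0 for infinite
  mass, the value 1 also excludes that case.\<close>

lemma emeasure_tree_law_0: "emeasure (\<rho> 0) UNIV = 1"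
proof -
  note b_component [measurable]
  let ?A = "{\<omega> \<in> space M. b \<omega> 0 = 0 \<and> b \<omega> (0 + 1) = b \<omega> 0 - 1}"
  have "?A = {\<omega> \<in> space M. b \<omega> (int 0) = 0 \<and> (\<forall>k<1. b \<omega> (int (Suc k)) - b \<omega> (int k) = -1)}"
    by auto
  then have A: "prob ?A = 1/2"
    using simple_random_walk_paths[OF b_right, of 1 "\<lambda>_. -1"] by simp
  have "{\<omega> \<in> space bridge_algebra. b \<omega> 0 = 0 \<and> b \<omega> (0 + 1) = b \<omega> 0 - 1} \<in> sets bridge_algebra"
    by measurable
  then have "?A \<in> sets bridge_algebra" by simp
  then have "prob {\<omega> \<in> ?A. \<forall>i\<in>{0}. T \<omega> i \<in> UNIV} = prob ?A * (\<Prod>i\<in>{0 :: int}. measure (\<rho> 0) UNIV)"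
    by (rule prob_trees[where \<beta> = "\<lambda>_. 0"]) (auto simp: DS_def)
  then have "measure (\<rho> 0) UNIV = 1" using A by simp
  then show ?thesis
    by (metis emeasure_eq_ennreal_measure ennreal_1 measure_zero_top zero_neq_one)
qed

definition tree_pmf :: "ltree pmf" where
  "tree_pmf = embed_pmf (\<lambda>t. measure (\<rho> 0) {t})"

lemma measure_tree_pmf: "measure_pmf tree_pmf = \<rho> 0"
proof -
  interpret R: prob_space "\<rho> 0" by (rule prob_space_tree_law[OF emeasure_tree_law_0])
  have sp: "sets (\<rho> 0) = UNIV" by (simp add: tree_law_def)
  have "(\<integral>\<^sup>+t. emeasure (\<rho> 0) {t} \<partial>count_space UNIV) = emeasure (\<rho> 0) UNIV"
    by (rule emeasure_countable_singleton[symmetric]) (auto simp: sp)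
  then have "pmf tree_pmf t = measure (\<rho> 0) {t}" for t
    unfolding tree_pmf_def
    by (subst pmf_embed_pmf) (auto simp: R.emeasure_eq_measure[symmetric] emeasure_tree_law_0)
  then show ?thesis
    by (intro measure_eqI_countable[where A = UNIV])
      (auto simp: sp emeasure_pmf_single R.emeasure_eq_measure)
qed

definition step_pmf :: "ltree option pmf" where
  "step_pmf = map_pmf (\<lambda>(c, t). if c then Some t else None) (pair_pmf (bernoulli_pmf (1/2)) tree_pmf)"

lemma measure_step_pmf_Some: "measure step_pmf (Some ` S) = measure (\<rho> 0) S / 2"
proof -
  have "(\<lambda>(c, t). if c then Some t else None) -` Some ` S = {True} \<times> S"
    by (auto split: if_splits)
  then show ?thesis
    unfolding step_pmf_def measure_map_pmf
    by (simp add: measure_pmf_prob_product measure_pmf_single measure_tree_pmf)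
qed

lemma pmf_step_pmf: "pmf step_pmf None = 1/2" "pmf step_pmf (Some t) = measure (\<rho> 0) {t} / 2"
proof -
  have "(\<lambda>(c, t). if c then Some t else None) -` {None} = {False} \<times> (UNIV :: ltree set)"
    by (auto split: if_splits)
  then show "pmf step_pmf None = 1/2"
    unfolding step_pmf_def measure_pmf_single[symmetric] measure_map_pmf
    by (simp add: measure_pmf_prob_product measure_pmf_single)
  show "pmf step_pmf (Some t) = measure (\<rho> 0) {t} / 2"
    using measure_step_pmf_Some[of "{t}"] by (simp add: measure_pmf_single)
qed

lemma step_pmf_tail:
  "min_label_bound x / 2 \<le> measure step_pmf (Some ` {t. \<forall>l\<in>tree_labels t. - int x < l})"
  using positive_labels_bound[OF emeasure_tree_law_0, of x] by (simp add: measure_step_pmf_Some)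

text \<open>The trees are known only through their law, so almost sure well-labeling and the correct
  root label are read off from the support of a step.\<close>

lemma set_step_pmf: "Some t \<in> set_pmf step_pmf \<Longrightarrow> well_labeled t \<and> root_label t = 0"
proof -
  assume "Some t \<in> set_pmf step_pmf"
  then have "pmf step_pmf (Some t) \<noteq> 0" by (simp add: set_pmf_iff)
  then have "emeasure (\<rho> 0) {t} \<noteq> 0" by (auto simp: pmf_step_pmf measure_def)
  moreover have "emeasure (\<rho> 0) {t} = (\<integral>\<^sup>+u. 0 \<partial>count_space (UNIV :: ltree set))"
    if "\<not> (well_labeled t \<and> root_label t = 0)"
    unfolding emeasure_tree_law
    by (rule nn_integral_cong) (use that in \<open>auto simp: tree_weight_def indicator_def\<close>)
  ultimately show ?thesis by auto
qed

lemma bridge_step_measurable [measurable]: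
  "(\<lambda>\<omega>. bridge_step (b \<omega>) (T \<omega>) i) \<in> M \<rightarrow>\<^sub>M count_space UNIV"
proof -
  have "(\<lambda>\<omega>. shift_tree (- b \<omega> i) (T \<omega> i)) \<in> M \<rightarrow>\<^sub>M count_space UNIV"
    by (rule measurable_compose_countable[OF _ b_component_M])
      (rule measurable_compose[OF T_component_M], simp)
  then show ?thesis
    unfolding bridge_step_def DS_def mem_Collect_eq by measurable
qed

text \<open>The hypothesis on \<open>A\<close> says that the pattern of down-steps prescribed by \<open>xs\<close> determines
  the labels of the positions visited by \<open>\<iota>\<close>.\<close>

lemma prob_window:
  fixes \<iota> :: "nat \<Rightarrow> int"
  assumes \<iota>: "inj \<iota>" and A: "A \<in> sets bridge_algebra"
    and on_A: "\<And>\<omega> k. \<omega> \<in> A \<Longrightarrow> k < length xs \<Longrightarrow>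
      (\<iota> k \<in> DS (b \<omega>) \<longleftrightarrow> xs ! k \<noteq> None) \<and> b \<omega> (\<iota> k) = \<beta> k"
    and all_A: "AE \<omega> in M. (\<forall>k<length xs. \<iota> k \<in> DS (b \<omega>) \<longleftrightarrow> xs ! k \<noteq> None) \<longrightarrow> \<omega> \<in> A"
    and prob_A: "prob A = (1/2) ^ length xs"
  shows "prob {\<omega> \<in> space M. map (\<lambda>k. bridge_step (b \<omega>) (T \<omega>) (\<iota> k)) [0..<length xs] = xs}
    = pmf (replicate_pmf (length xs) step_pmf) xs"
proof -
  let ?n = "length xs"
  let ?X = "\<lambda>\<omega> k. bridge_step (b \<omega>) (T \<omega>) (\<iota> k)"
  define K where "K = {k. k < ?n \<and> xs ! k \<noteq> None}"
  have K_fin: "finite (\<iota> ` K)" by (auto simp: K_def)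
  define \<kappa> where "\<kappa> = inv_into UNIV \<iota>"
  have \<kappa>: "\<kappa> (\<iota> k) = k" for k unfolding \<kappa>_def using \<iota> by simp
  define B where "B i = {shift_tree (\<beta> (\<kappa> i)) (the (xs ! \<kappa> i))}" for i
  have AM: "A \<in> sets M" using A subalgebra_bridge by (auto simp: subalgebra_def)
  have eq: "map (?X \<omega>) [0..<?n] = xs \<longleftrightarrow> (\<forall>k<?n. ?X \<omega> k = xs ! k)" for \<omega>
    by (subst list_eq_iff_nth_eq) simp
  have on: "map (?X \<omega>) [0..<?n] = xs \<longleftrightarrow> (\<forall>i\<in>\<iota> ` K. T \<omega> i \<in> B i)" if "\<omega> \<in> A" for \<omega>
  proof -
    have "?X \<omega> k = xs ! k \<longleftrightarrow> (k \<in> K \<longrightarrow> T \<omega> (\<iota> k) \<in> B (\<iota> k))" if k: "k < ?n" for k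
      using on_A[OF \<open>\<omega> \<in> A\<close> k] k
      by (cases "xs ! k") (simp_all add: bridge_step_def K_def B_def \<kappa> shift_tree_eq_iff)
    then have "(\<forall>k<?n. ?X \<omega> k = xs ! k) \<longleftrightarrow> (\<forall>k<?n. k \<in> K \<longrightarrow> T \<omega> (\<iota> k) \<in> B (\<iota> k))"
      by blast
    moreover have "k < ?n" if "k \<in> K" for k using that by (simp add: K_def)
    ultimately show ?thesis unfolding eq by blast
  qed
  have "prob {\<omega> \<in> space M. map (?X \<omega>) [0..<?n] = xs} = prob {\<omega> \<in> A. \<forall>i\<in>\<iota> ` K. T \<omega> i \<in> B i}"
  proof (rule finite_measure_eq_AE)
    show "AE \<omega> in M. \<omega> \<in> {\<omega> \<in> space M. map (?X \<omega>) [0..<?n] = xs} \<longleftrightarrow>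
        \<omega> \<in> {\<omega> \<in> A. \<forall>i\<in>\<iota> ` K. T \<omega> i \<in> B i}"
      using all_A AE_space
    proof eventually_elim
      case (elim \<omega>)
      have "\<iota> k \<in> DS (b \<omega>) \<longleftrightarrow> xs ! k \<noteq> None" if "map (?X \<omega>) [0..<?n] = xs" "k < ?n" for k
      proof -
        have "?X \<omega> k = xs ! k" using that eq by blast
        then show ?thesis by (cases "xs ! k") (simp_all add: bridge_step_def split: if_splits)
      qed
      then show ?case using elim on[of \<omega>] by blast
    qed
    show "{\<omega> \<in> space M. map (?X \<omega>) [0..<?n] = xs} \<in> sets M"
      unfolding eq by measurable
    have "{\<omega> \<in> space M. \<forall>i\<in>\<iota> ` K. T \<omega> i \<in> B i} \<in> sets M"
      using K_fin by measurable
    then have "A \<inter> {\<omega> \<in> space M. \<forall>i\<in>\<iota> ` K. T \<omega> i \<in> B i} \<in> sets M" using AM by blast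
    also have "A \<inter> {\<omega> \<in> space M. \<forall>i\<in>\<iota> ` K. T \<omega> i \<in> B i} = {\<omega> \<in> A. \<forall>i\<in>\<iota> ` K. T \<omega> i \<in> B i}"
      using sets.sets_into_space[OF AM] by auto
    finally show "{\<omega> \<in> A. \<forall>i\<in>\<iota> ` K. T \<omega> i \<in> B i} \<in> sets M" .
  qed
  also have "\<dots> = prob A * (\<Prod>i\<in>\<iota> ` K. measure (\<rho> (\<beta> (\<kappa> i))) (B i))"
  proof (rule prob_trees[OF A K_fin])
    fix \<omega> i assume "\<omega> \<in> A" "i \<in> \<iota> ` K"
    then obtain k where "\<omega> \<in> A" "k \<in> K" "i = \<iota> k" by blast
    then show "i \<in> DS (b \<omega>) \<and> b \<omega> i = \<beta> (\<kappa> i)"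
      using on_A[of \<omega> k] by (simp add: K_def \<kappa>)
  qed
  also have "(\<Prod>i\<in>\<iota> ` K. measure (\<rho> (\<beta> (\<kappa> i))) (B i)) = (\<Prod>k\<in>K. measure (\<rho> 0) {the (xs ! k)})"
    using inj_on_subset[OF \<iota>]
    by (subst prod.reindex) (auto simp: B_def \<kappa> measure_tree_law_singleton_shift)
  also have "\<dots> = (\<Prod>k<?n. if k \<in> K then measure (\<rho> 0) {the (xs ! k)} else 1)"
    by (intro prod.mono_neutral_cong_left) (auto simp: K_def)
  \<comment> \<open>The probability of the path contributes one factor \<open>1/2\<close> to each
    entry, whether it is an up-step or a down-step.\<close>
  also have "prob A * \<dots> = (\<Prod>k<?n. 1/2 * (if k \<in> K then measure (\<rho> 0) {the (xs ! k)} else 1))"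
    unfolding prob_A prod.distrib by simp
  also have "\<dots> = (\<Prod>k<?n. pmf step_pmf (xs ! k))"
  proof (rule prod.cong)
    fix k assume "k \<in> {..<?n}"
    then show "1/2 * (if k \<in> K then measure (\<rho> 0) {the (xs ! k)} else 1) = pmf step_pmf (xs ! k)"
      by (cases "xs ! k") (auto simp: K_def pmf_step_pmf)
  qed simp
  finally show ?thesis by (simp add: pmf_replicate_pmf)
qed

lemma iid_sequence_bridge_step:
  fixes \<iota> :: "nat \<Rightarrow> int"
  assumes "\<And>xs. prob {\<omega> \<in> space M. map (\<lambda>k. bridge_step (b \<omega>) (T \<omega>) (\<iota> k)) [0..<length xs] = xs}
    = pmf (replicate_pmf (length xs) step_pmf) xs"
  shows "iid_sequence M (\<lambda>\<omega> k. bridge_step (b \<omega>) (T \<omega>) (\<iota> k)) step_pmf"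
proof
  fix n
  let ?X = "\<lambda>\<omega>. map (\<lambda>k. bridge_step (b \<omega>) (T \<omega>) (\<iota> k)) [0..<n]"
  have X: "?X \<in> M \<rightarrow>\<^sub>M count_space UNIV"
    unfolding measurable_count_space_eq2_countable
  proof (intro conjI ballI)
    fix xs
    have "{\<omega> \<in> space M. \<forall>k<n. bridge_step (b \<omega>) (T \<omega>) (\<iota> k) = xs ! k} \<in> sets M" by measurable
    moreover have "?X -` {xs} \<inter> space M = (if length xs = n
        then {\<omega> \<in> space M. \<forall>k<n. bridge_step (b \<omega>) (T \<omega>) (\<iota> k) = xs ! k} else {})"
    proof (cases "length xs = n")
      case True
      then have "?X \<omega> = xs \<longleftrightarrow> (\<forall>k<n. bridge_step (b \<omega>) (T \<omega>) (\<iota> k) = xs ! k)" for \<omega>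
        by (subst list_eq_iff_nth_eq) simp
      then show ?thesis using True by auto
    next
      case False
      then have "?X \<omega> \<noteq> xs" for \<omega> by (metis diff_zero length_map length_upt)
      then show ?thesis using False by auto
    qed
    ultimately show "?X -` {xs} \<inter> space M \<in> sets M" by simp
  qed auto
  show "distr M (count_space UNIV) ?X = measure_pmf (replicate_pmf n step_pmf)"
  proof (rule measure_eqI_countable[where A = UNIV])
    fix xs
    have "measure (distr M (count_space UNIV) ?X) {xs} = prob {\<omega> \<in> space M. ?X \<omega> = xs}"
      using X by (subst measure_distr) (auto intro!: arg_cong[of _ _ prob])
    also have "\<dots> = pmf (replicate_pmf n step_pmf) xs"
    proof (cases "length xs = n")
      case True
      then show ?thesis using assms[of xs] by simp
    next
      case False
      then have "?X \<omega> \<noteq> xs" for \<omega> by (metis diff_zero length_map length_upt)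
      then have "prob {\<omega> \<in> space M. ?X \<omega> = xs} = 0" by simp
      moreover have "pmf (replicate_pmf n step_pmf) xs = 0"
        using False by (auto simp: pmf_eq_0_set_pmf set_replicate_pmf)
      ultimately show ?thesis by simp
    qed
    finally show "emeasure (distr M (count_space UNIV) ?X) {xs} = emeasure (replicate_pmf n step_pmf) {xs}"
      using X prob_space.finite_measure[OF prob_space_distr[OF X]]
      by (simp add: finite_measure.emeasure_eq_measure emeasure_pmf_single)
  qed auto
qed measurable

lemma AE_steps: "AE \<omega> in M. b \<omega> 0 = 0 \<and> (\<forall>i. b \<omega> (i + 1) - b \<omega> i \<in> {-1, 1})"
  using simple_random_walk_AE[OF b_right] simple_random_walk_AE[OF b_left]
proof eventually_elim
  case (elim \<omega>)
  have "b \<omega> (i + 1) - b \<omega> i \<in> {-1, 1}" for i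
  proof (cases "0 \<le> i")
    case True
    then obtain k where k: "i = int k" by (rule nonneg_int_cases)
    have "i + 1 = int (Suc k)" using k by simp
    moreover have "b \<omega> (int (Suc k)) - b \<omega> (int k) \<in> {-1, 1}" using elim(1) by blast
    ultimately show ?thesis by (simp add: k add.commute)
  next
    case False
    define k where "k = nat (- i - 1)"
    have k: "i = - int (Suc k)" "i + 1 = - int k" using False by (auto simp: k_def)
    have "b \<omega> (- int (Suc k)) - b \<omega> (- int k) \<in> {-1, 1}" using elim(2) by blast
    then show ?thesis unfolding k by auto
  qed
  then show ?case using elim by simp
qed

lemma bridge_algebra_walk:
  "{\<omega> \<in> space M. b \<omega> i = 0 \<and> (\<forall>k<n. b \<omega> (f k) - b \<omega> (g k) = s k)} \<in> sets bridge_algebra"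
    for f g :: "nat \<Rightarrow> int"
proof -
  have diff: "{\<omega> \<in> space bridge_algebra. b \<omega> j - b \<omega> j' = c} \<in> sets bridge_algebra" for j j' c
  proof -
    have "(\<lambda>\<omega>. x - b \<omega> j') \<in> bridge_algebra \<rightarrow>\<^sub>M count_space UNIV" for x
      by (rule measurable_compose[OF b_component]) simp
    from measurable_compose_countable[OF this b_component]
    have "(\<lambda>\<omega>. b \<omega> j - b \<omega> j') \<in> bridge_algebra \<rightarrow>\<^sub>M count_space UNIV" .
    from measurable_sets[OF this, of "{c}"] show ?thesis
      by (simp add: vimage_def Int_def conj_commute)
  qed
  have zero: "{\<omega> \<in> space bridge_algebra. b \<omega> i = 0} \<in> sets bridge_algebra"
    using measurable_sets[OF b_component, of "{0}" i] by (simp add: vimage_def Int_def conj_commute)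
  have "{\<omega> \<in> space bridge_algebra. \<forall>k\<in>{..<n}. b \<omega> (f k) - b \<omega> (g k) = s k} \<in> sets bridge_algebra"
    by (rule sets.sets_Collect_finite_All) (rule diff, rule finite_lessThan)
  from sets.sets_Collect_conj[OF this zero] show ?thesis
    unfolding space_vimage_algebra Ball_def lessThan_iff .
qed

lemma iid_right: "iid_sequence M (\<lambda>\<omega> k. bridge_step (b \<omega>) (T \<omega>) (int k)) step_pmf"
proof (rule iid_sequence_bridge_step)
  fix xs :: "ltree option list"
  let ?s = "\<lambda>k. block_step (xs ! k)"
  let ?P = "\<lambda>\<omega>. b \<omega> (int 0) = 0 \<and> (\<forall>k<length xs. b \<omega> (int (Suc k)) - b \<omega> (int k) = ?s k)"
  have A: "{\<omega> \<in> space M. ?P \<omega>} \<in> sets bridge_algebra" by (rule bridge_algebra_walk)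
  have b_eq: "b \<omega> (int k) = (\<Sum>j<k. ?s j)" if "?P \<omega>" "k \<le> length xs" for \<omega> k
    using that(2)
  proof (induction k)
    case (Suc k)
    then have "k < length xs" by simp
    then have "b \<omega> (int (Suc k)) - b \<omega> (int k) = ?s k" using that(1) by blast
    moreover have "b \<omega> (int k) = (\<Sum>j<k. ?s j)" using Suc by simp
    ultimately show ?case unfolding sum.lessThan_Suc by linarith
  qed (use that(1) in simp)
  show "prob {\<omega> \<in> space M. map (\<lambda>k. bridge_step (b \<omega>) (T \<omega>) (int k)) [0..<length xs] = xs}
    = pmf (replicate_pmf (length xs) step_pmf) xs"
  proof (rule prob_window[OF _ A])
    fix \<omega> k assume \<omega>: "\<omega> \<in> {\<omega> \<in> space M. ?P \<omega>}" and k: "k < length xs"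
    have P: "?P \<omega>" using \<omega> by blast
    then have "b \<omega> (int (Suc k)) - b \<omega> (int k) = ?s k" using k by blast
    then have "int k \<in> DS (b \<omega>) \<longleftrightarrow> xs ! k \<noteq> None"
      by (simp add: DS_def block_step_def add.commute split: if_splits)
    then show "(int k \<in> DS (b \<omega>) \<longleftrightarrow> xs ! k \<noteq> None) \<and> b \<omega> (int k) = (\<Sum>j<k. ?s j)"
      using b_eq[OF P, of k] k by simp
  next
    show "AE \<omega> in M. (\<forall>k<length xs. int k \<in> DS (b \<omega>) \<longleftrightarrow> xs ! k \<noteq> None) \<longrightarrow> \<omega> \<in> {\<omega> \<in> space M. ?P \<omega>}"
      using AE_steps AE_space
    proof eventually_elim
      case (elim \<omega>)
      show ?case
      proof
        assume ds: "\<forall>k<length xs. int k \<in> DS (b \<omega>) \<longleftrightarrow> xs ! k \<noteq> None"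
        have "b \<omega> (int (Suc k)) - b \<omega> (int k) = ?s k" if "k < length xs" for k
        proof -
          have "b \<omega> (int k + 1) - b \<omega> (int k) \<in> {-1, 1}" using elim by blast
          moreover have "b \<omega> (int k + 1) = b \<omega> (int k) - 1 \<longleftrightarrow> xs ! k \<noteq> None"
            using ds that by (simp add: DS_def)
          ultimately show ?thesis by (auto simp: block_step_def add.commute)
        qed
        then show "\<omega> \<in> {\<omega> \<in> space M. ?P \<omega>}" using elim by simp
      qed
    qed
    show "prob {\<omega> \<in> space M. ?P \<omega>} = (1/2) ^ length xs"
      by (rule simple_random_walk_paths[OF b_right]) (simp add: block_step_def)
  qed (simp add: inj_def)
qed

text \<open>Read leftwards, entry \<open>k\<close> is the step between \<open>- k - 1\<close> and
  \<open>- k\<close>, and its tree sits at the left end. Hence the sign of \<open>block_step\<close>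
  is reversed and the label of the root is the partial sum including entry \<open>k\<close>.\<close>

lemma iid_left: "iid_sequence M (\<lambda>\<omega> k. bridge_step (b \<omega>) (T \<omega>) (- int (Suc k))) step_pmf"
proof (rule iid_sequence_bridge_step)
  fix xs :: "ltree option list"
  let ?s = "\<lambda>k. - block_step (xs ! k)"
  let ?P = "\<lambda>\<omega>. b \<omega> (- int 0) = 0 \<and> (\<forall>k<length xs. b \<omega> (- int (Suc k)) - b \<omega> (- int k) = ?s k)"
  have A: "{\<omega> \<in> space M. ?P \<omega>} \<in> sets bridge_algebra" by (rule bridge_algebra_walk)
  have b_eq: "b \<omega> (- int k) = (\<Sum>j<k. ?s j)" if "?P \<omega>" "k \<le> length xs" for \<omega> k
    using that(2)
  proof (induction k)
    case (Suc k)
    then have "k < length xs" by simp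
    then have "b \<omega> (- int (Suc k)) - b \<omega> (- int k) = ?s k" using that(1) by blast
    moreover have "b \<omega> (- int k) = (\<Sum>j<k. ?s j)" using Suc by simp
    ultimately show ?case unfolding sum.lessThan_Suc by linarith
  qed (use that(1) in simp)
  have next_pos: "- int (Suc k) + 1 = - int k" for k by simp
  show "prob {\<omega> \<in> space M. map (\<lambda>k. bridge_step (b \<omega>) (T \<omega>) (- int (Suc k))) [0..<length xs] = xs}
    = pmf (replicate_pmf (length xs) step_pmf) xs"
  proof (rule prob_window[OF _ A])
    fix \<omega> k assume \<omega>: "\<omega> \<in> {\<omega> \<in> space M. ?P \<omega>}" and k: "k < length xs"
    have P: "?P \<omega>" using \<omega> by blast
    then have "b \<omega> (- int (Suc k)) - b \<omega> (- int k) = ?s k" using k by blast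
    then have "- int (Suc k) \<in> DS (b \<omega>) \<longleftrightarrow> xs ! k \<noteq> None"
      unfolding DS_def mem_Collect_eq next_pos by (simp add: block_step_def split: if_splits)
    then show "(- int (Suc k) \<in> DS (b \<omega>) \<longleftrightarrow> xs ! k \<noteq> None) \<and> b \<omega> (- int (Suc k)) = (\<Sum>j<Suc k. ?s j)"
      using b_eq[OF P, of "Suc k"] k by simp
  next
    show "AE \<omega> in M. (\<forall>k<length xs. - int (Suc k) \<in> DS (b \<omega>) \<longleftrightarrow> xs ! k \<noteq> None) \<longrightarrow> \<omega> \<in> {\<omega> \<in> space M. ?P \<omega>}"
      using AE_steps AE_space
    proof eventually_elim
      case (elim \<omega>)
      show ?case
      proof
        assume ds: "\<forall>k<length xs. - int (Suc k) \<in> DS (b \<omega>) \<longleftrightarrow> xs ! k \<noteq> None"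
        have "b \<omega> (- int (Suc k)) - b \<omega> (- int k) = ?s k" if "k < length xs" for k
        proof -
          have "b \<omega> (- int (Suc k) + 1) - b \<omega> (- int (Suc k)) \<in> {-1, 1}" using elim by blast
          then show ?thesis
            using ds that unfolding DS_def mem_Collect_eq next_pos
            by (auto simp: block_step_def)
        qed
        then show "\<omega> \<in> {\<omega> \<in> space M. ?P \<omega>}" using elim by simp
      qed
    qed
    show "prob {\<omega> \<in> space M. ?P \<omega>} = (1/2) ^ length xs"
      by (rule simple_random_walk_paths[OF b_left]) (simp add: block_step_def)
  qed (simp add: inj_def)
qed

end

section \<open>Almost sure recurrence\<close>

context labeled_bridge
begin

abbreviation "st \<equiv> bridge_step b T"

lemma depth_step_bridge: "depth_step \<sigma> (st i) = \<sigma> * (b i - b (i + 1))"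
  using step[of i] by (auto simp: depth_step_def bridge_step_def DS_def)

lemma depth_right: "i \<le> n \<Longrightarrow> depth 1 (map (\<lambda>k. st (int k)) [i..<n]) = b (int i) - b (int n)"
proof (induction i rule: inc_induct)
  case (step i)
  then show ?case by (simp add: upt_conv_Cons depth_step_bridge add.commute)
qed simp

lemma depth_left:
  "i \<le> n \<Longrightarrow> depth (-1) (map (\<lambda>k. st (- int (Suc k))) [i..<n]) = b (- int i) - b (- int n)"
proof (induction i rule: inc_induct)
  case (step i)
  have "- int (Suc i) + 1 = - int i" by simp
  then have "depth_step (-1) (st (- int (Suc i))) = b (- int i) - b (- int (Suc i))"
    unfolding depth_step_bridge by simp
  then show ?case using step by (simp add: upt_conv_Cons)
qed simp

lemma labels_above_bridge_step:
  assumes "labels_above (st i) y" "i \<in> DS b" "l \<in> tree_labels (T i)"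
  shows "b i - y < l"
proof -
  have "l - b i \<in> tree_labels (shift_tree (- b i) (T i))"
    using assms(3) by (force simp: tree_labels_shift_tree)
  then show ?thesis using assms(1,2) by (force simp: labels_above_def bridge_step_def)
qed

lemma good_right:
  assumes "good 1 (map (\<lambda>k. st (int k)) [i..<n])" "i \<le> m" "m < n" "int m \<in> DS b"
    "l \<in> tree_labels (T (int m))"
  shows "b (int n) < l"
proof -
  let ?f = "\<lambda>k. st (int k)"
  have "[i..<n] = [i..<m] @ m # [Suc m..<n]"
    using assms(2,3) upt_add_eq_append[of i m "n - m"] by (simp add: upt_conv_Cons)
  then have "good 1 (map ?f [i..<m] @ map ?f (m # [Suc m..<n]))"
    using assms(1) by (simp only: map_append)
  then have "good 1 (map ?f (m # [Suc m..<n]))" by (rule good_appendD)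
  then have "labels_above (?f m) (max (depth 1 (map ?f [Suc m..<n])) (depth 1 (map ?f (m # [Suc m..<n]))))"
    by simp
  moreover have "depth 1 (map ?f (m # [Suc m..<n])) = b (int m) - b (int n)"
    using depth_right[of m n] assms(3) by (simp only: upt_conv_Cons less_imp_le)
  moreover have "depth 1 (map ?f [Suc m..<n]) = b (int m) - 1 - b (int n)"
    using depth_right[of "Suc m" n] assms(3,4) by (simp add: DS_def add.commute)
  ultimately have "labels_above (?f m) (b (int m) - b (int n))" by (simp add: max_def)
  from labels_above_bridge_step[OF this assms(4,5)] show ?thesis by simp
qed

lemma good_left:
  assumes "good (-1) (map (\<lambda>k. st (- int (Suc k))) [i..<n])" "i \<le> m" "m < n"
    "- int (Suc m) \<in> DS b" "l \<in> tree_labels (T (- int (Suc m)))"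
  shows "b (- int n) < l"
proof -
  let ?f = "\<lambda>k. st (- int (Suc k))"
  have "[i..<n] = [i..<m] @ m # [Suc m..<n]"
    using assms(2,3) upt_add_eq_append[of i m "n - m"] by (simp add: upt_conv_Cons)
  then have "good (-1) (map ?f [i..<m] @ map ?f (m # [Suc m..<n]))"
    using assms(1) by (simp only: map_append)
  then have "good (-1) (map ?f (m # [Suc m..<n]))" by (rule good_appendD)
  then have "labels_above (?f m) (max (depth (-1) (map ?f [Suc m..<n])) (depth (-1) (map ?f (m # [Suc m..<n]))))"
    by simp
  moreover have "depth (-1) (map ?f (m # [Suc m..<n])) = b (- int m) - b (- int n)"
    using depth_left[of m n] assms(3) by (simp only: upt_conv_Cons less_imp_le)
  moreover have "depth (-1) (map ?f [Suc m..<n]) = b (- int (Suc m)) - b (- int n)"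
    using depth_left[of "Suc m" n] assms(3) by simp
  \<comment> \<open>Read leftwards, a down-step raises the walk, so the root height is the depth of
    the remaining list and the maximum selects that one.\<close>
  moreover have "b (- int m) = b (- int (Suc m)) - 1"
  proof -
    have "- int (Suc m) + 1 = - int m" by simp
    then show ?thesis using assms(4) unfolding DS_def mem_Collect_eq by (simp only:)
  qed
  ultimately have "labels_above (?f m) (b (- int (Suc m)) - b (- int n))"
    by (simp only: max_def) (simp split: if_splits)
  from labels_above_bridge_step[OF this assms(4,5)] show ?thesis by simp
qed

text \<open>The first \<open>n\<close> entries being good places \<open>b n\<close> below the trees
  on \<open>[0, n)\<close>. The last entry alone is good as well, and a single entry of positive
  depth is a down-step, so \<open>n\<close> carries a real vertex.\<close>

lemma record_of_good_down:
  assumes "good_down (map (\<lambda>k. st (int k)) [0..<Suc n])"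
  shows "is_record 0 (int n)"
proof -
  let ?f = "\<lambda>k. st (int k)"
  have g: "good 1 (map ?f [0..<Suc n])" "good 1 (map ?f [0..<n])"
    using assms by (auto simp: good_down_def map_butlast[symmetric])
  have "good 1 (map ?f [0..<n] @ [?f n])" using g(1) by simp
  then have "good 1 [?f n]" by (rule good_appendD)
  then have "int n \<in> DS b" by (auto simp: depth_step_def bridge_step_def split: if_splits)
  moreover have "b (int n) < l" if "m \<in> {0..<int n} \<inter> DS b" "l \<in> tree_labels (T m)" for m l
  proof -
    from that(1) obtain k where "m = int k" by (auto elim: nonneg_int_cases)
    then show ?thesis using good_right[OF g(2), of k l] that by simp
  qed
  ultimately show ?thesis by (simp add: is_record_def)
qed

lemma barrier_of_good:
  assumes "good (-1) (map (\<lambda>k. st (- int (Suc k))) [0..<n])" "0 < n"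
  shows "is_barrier (- int n)"
proof -
  have "b (- int n) < l" if "m \<in> {- int n..<0} \<inter> DS b" "l \<in> tree_labels (T m)" for m l
  proof -
    define k where "k = nat (- m - 1)"
    have "m = - int (Suc k)" "k < n" using that(1) by (auto simp: k_def)
    then show ?thesis using good_left[OF assms(1), of k l] that by simp
  qed
  then show ?thesis using assms(2) by (auto simp: is_barrier_def)
qed

end

lemma recurrent_labeled_bridgeI:
  assumes bridge: "labeled_bridge b T"
    and right: "infinite {n. good_down (map (\<lambda>k. bridge_step b T (int k)) [0..<n])}"
    and left: "infinite {n. good (-1) (map (\<lambda>k. bridge_step b T (- int (Suc k))) [0..<n])}"
  shows "recurrent_labeled_bridge b T"
proof -
  interpret labeled_bridge b T by (rule bridge)
  show ?thesis
  proof
    let ?G = "{n. good_down (map (\<lambda>k. bridge_step b T (int k)) [0..<n])}"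
    have "int n - 1 \<in> {j. 0 \<le> j \<and> is_record 0 j}" if "n \<in> ?G" for n
      using that record_of_good_down[of "n - 1"] by (cases n) (auto simp: good_down_def)
    then have "(\<lambda>n. int n - 1) ` ?G \<subseteq> {j. 0 \<le> j \<and> is_record 0 j}" by blast
    moreover have "infinite ((\<lambda>n. int n - 1) ` ?G)"
      using right by (subst finite_image_iff) (auto simp: inj_on_def)
    ultimately show "infinite {j. 0 \<le> j \<and> is_record 0 j}" by (rule infinite_super)
  next
    let ?G = "{n. good (-1) (map (\<lambda>k. bridge_step b T (- int (Suc k))) [0..<n])}"
    have "(\<lambda>n. - int n) ` (?G - {0}) \<subseteq> {i. is_barrier i}" using barrier_of_good by auto
    moreover have "infinite ((\<lambda>n. - int n) ` (?G - {0}))"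
      using left by (subst finite_image_iff) (auto simp: inj_on_def)
    ultimately show "infinite {i. is_barrier i}" by (rule infinite_super)
  qed
qed

context iid_sequence
begin

lemma AE_in_support: "AE \<omega> in M. \<forall>n. X \<omega> n \<in> set_pmf p"
proof -
  have "AE \<omega> in M. X \<omega> n \<in> set_pmf p" for n
  proof -
    have "AE xs in replicate_pmf (Suc n) p. xs \<in> lists (set_pmf p)"
      by (auto simp: AE_measure_pmf_iff set_replicate_pmf simp del: replicate_pmf.simps)
    then have "AE xs in distr M (count_space UNIV) (\<lambda>\<omega>. map (X \<omega>) [0..<Suc n]). xs \<in> lists (set_pmf p)"
      unfolding X_law .
    then have "AE \<omega> in M. map (X \<omega>) [0..<Suc n] \<in> lists (set_pmf p)"
      by (subst (asm) AE_distr_iff) (rule measurable_block, auto)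
    then show ?thesis by eventually_elim simp
  qed
  then show ?thesis by (simp add: AE_all_countable)
qed

end

lemma (in uniform_infinite_treed_bridge) AE_recurrent_labeled_bridge:
  "AE \<omega> in M. recurrent_labeled_bridge (b \<omega>) (T \<omega>)"
proof -
  interpret R: iid_sequence M "\<lambda>\<omega> k. bridge_step (b \<omega>) (T \<omega>) (int k)" step_pmf by (rule iid_right)
  interpret L: iid_sequence M "\<lambda>\<omega> k. bridge_step (b \<omega>) (T \<omega>) (- int (Suc k))" step_pmf by (rule iid_left)
  have "AE \<omega> in M. infinite {n. good_down (map (\<lambda>k. bridge_step (b \<omega>) (T \<omega>) (int k)) [0..<n])}"
  proof (rule R.infinitely_many_good_blocks)
    fix xs ys
    assume "good_down (xs @ ys)" "good_down xs" "ys \<noteq> []"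
    then show "good_down ys"
      by (auto simp: good_down_def butlast_append dest: good_appendD)
  next
    fix xs ys
    assume "good_down xs" "good_down ys"
    then show "good_down (xs @ ys)"
      by (auto simp: good_down_def butlast_append intro: good_append)
  qed (rule not_summable_good_down[OF pmf_step_pmf(1) step_pmf_tail])
  moreover have "AE \<omega> in M. infinite {n. good (-1) (map (\<lambda>k. bridge_step (b \<omega>) (T \<omega>) (- int (Suc k))) [0..<n])}"
    by (rule L.infinitely_many_good_blocks)
      (auto intro: good_append dest: good_appendD simp: not_summable_good[OF pmf_step_pmf(1) step_pmf_tail])
  ultimately show ?thesis
    using AE_steps R.AE_in_support L.AE_in_support
  proof eventually_elim
    case (elim \<omega>)
    have supp: "bridge_step (b \<omega>) (T \<omega>) i \<in> set_pmf step_pmf" for i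
    proof (cases "0 \<le> i")
      case True
      then show ?thesis using elim(4) by (metis nonneg_int_cases)
    next
      case False
      then have "i = - int (Suc (nat (- i - 1)))" by simp
      then show ?thesis using elim(5) by metis
    qed
    have "labeled_bridge (b \<omega>) (T \<omega>)"
    proof
      fix i
      have "b \<omega> (i + 1) - b \<omega> i \<in> {-1, 1}" using elim(3) by blast
      then show "b \<omega> (i + 1) = b \<omega> i - 1 \<or> b \<omega> (i + 1) = b \<omega> i + 1" by auto
    next
      fix i assume "i \<in> DS (b \<omega>)"
      then show "well_labeled (T \<omega> i) \<and> root_label (T \<omega> i) = b \<omega> i"
        using set_step_pmf[of "shift_tree (- b \<omega> i) (T \<omega> i)"] supp[of i]
        by (simp add: bridge_step_def)
    qed
    then show ?case using elim(1,2) by (rule recurrent_labeled_bridgeI)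
  qed
qed

theorem theorem1:
  fixes M :: "'w measure" and b :: "'w \<Rightarrow> int \<Rightarrow> int" and T :: "'w \<Rightarrow> int \<Rightarrow> ltree"
  assumes "uniform_infinite_treed_bridge M b T"
  shows "(AE \<omega> in M. \<forall>\<gamma>. geodesic_ray (uihpq (b \<omega>) (T \<omega>)) \<gamma> \<longrightarrow>
            infinite {n. \<gamma> n \<in> boundary (b \<omega>) (T \<omega>)})
       \<and> (AE \<omega> in M. \<exists>v :: nat \<Rightarrow> vertex.
            inj v \<and> range v \<subseteq> boundary (b \<omega>) (T \<omega>) \<and>
            (\<forall>\<gamma>. geodesic_ray (uihpq (b \<omega>) (T \<omega>)) \<gamma> \<longrightarrow> finite {k. v k \<notin> range \<gamma>}))"
proof -
  interpret uniform_infinite_treed_bridge M b T by (rule assms)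
  show ?thesis
  proof
    show "AE \<omega> in M. \<forall>\<gamma>. geodesic_ray (uihpq (b \<omega>) (T \<omega>)) \<gamma> \<longrightarrow>
        infinite {n. \<gamma> n \<in> boundary (b \<omega>) (T \<omega>)}"
      using AE_recurrent_labeled_bridge
      by eventually_elim (intro allI impI recurrent_labeled_bridge.ray_hits_boundary)
    show "AE \<omega> in M. \<exists>v :: nat \<Rightarrow> vertex.
        inj v \<and> range v \<subseteq> boundary (b \<omega>) (T \<omega>) \<and>
        (\<forall>\<gamma>. geodesic_ray (uihpq (b \<omega>) (T \<omega>)) \<gamma> \<longrightarrow> finite {k. v k \<notin> range \<gamma>})"
      using AE_recurrent_labeled_bridge
      by eventually_elim (rule recurrent_labeled_bridge.confluence)
  qed
qed

end
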